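(* Let $M$ be a 3-dimensional normal almost paracontact metric manifold with structure $(\varphi,\xi,\eta,g)$ and associated functions $\alpha,\beta$. Let $\gamma\colon I\to M$ be a slant non-geodesic null curve, with $\eta(\dot\gamma)=c$ constant, parametrized so that $g(\nabla_{\dot\gamma}\dot\gamma,\nabla_{\dot\gamma}\dot\gamma)=1$. Then, for one choice of sign (upper signs throughout, or lower signs throughout), the function $\tau$ and the vector fields $N,W$ of the Cartan frame of $\gamma$ are $$\tau=-\frac{\alpha^2c^2}{2}-\dot\alpha c\pm\beta-\frac{1}{2c^2},$$ $$N=\alpha c\,\dot\gamma\pm\frac1c\,\varphi\dot\gamma,$$ $$W=\frac{-\alpha^2c^2-1}{2c}\,\dot\gamma\mp\alpha\,\varphi\dot\gamma+\frac{1}{c^2}\,\xi,$$ where $\alpha,\beta$ stand for $\alpha\circ\gamma,\beta\circ\gamma$ (a dot denotes the derivative along $\gamma$).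
   Context: An almost paracontact structure on a $(2n+1)$-dimensional manifold $M$ is a triple $(\varphi,\xi,\eta)$ of a $(1,1)$-tensor field, a vector field and a 1-form with $\eta(\xi)=1$, $\varphi^2=\mathrm{Id}-\eta\otimes\xi$, and such that the eigendistributions of $\varphi$ on $\ker\eta$ for the eigenvalues $1$ and $-1$ both have dimension $n$. It is almost paracontact metric if $M$ also carries a pseudo-Riemannian metric $g$ of signature $(n+1,n)$ with $g(\varphi X,\varphi Y)=-g(X,Y)+\eta(X)\eta(Y)$; then $\eta(X)=g(X,\xi)$, $\varphi\xi=0$, $\eta\circ\varphi=0$, and $g(X,\varphi Y)$ is skew-symmetric. It is normal if $[\varphi,\varphi](X,Y)-2\,d\eta(X,Y)\xi=0$, where $[\varphi,\varphi](X,Y)=\varphi^2[X,Y]+[\varphi X,\varphi Y]-\varphi[\varphi X,Y]-\varphi[X,\varphi Y]$. Here $n=1$, $\nabla$ is the Levi-Civita connection of $g$, and it is known that normality is equivalent to the existence of functions $\alpha,\beta$ on $M$ with $\nabla_X\xi=\alpha(X-\eta(X)\xi)+\beta\varphi X$, and equivalent to $(\nabla_X\varphi)Y=\beta(g(X,Y)\xi-\eta(Y)X)+\alpha(g(\varphi X,Y)\xi-\eta(Y)\varphi X)$ for functions $\alpha,\beta$; these functions are given by $2\alpha=\mathrm{Trace}\{X\mapsto\nabla_X\xi\}$, $2\beta=\mathrm{Trace}\{X\mapsto\varphi\nabla_X\xi\}$. A curve $\gamma\colon I\to M$ ($I$ an interval) is slant if $g(\dot\gamma,\xi)=\eta(\dot\gamma)=c$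 is constant; it is null if $g(\dot\gamma,\dot\gamma)=0$. For a null curve that is not a geodesic one has $g(\nabla_{\dot\gamma}\dot\gamma,\nabla_{\dot\gamma}\dot\gamma)\neq0$, and it is then parametrized so that this quantity equals $1$. Its Cartan frame is defined by $T=\dot\gamma$, $N=\nabla_{\dot\gamma}T$, $\tau=\frac12g(\nabla_{\dot\gamma}N,\nabla_{\dot\gamma}N)$, $W=-\nabla_{\dot\gamma}N-\tau T$, where $g(T,W)=g(N,N)=1$ and $g(T,T)=g(T,N)=g(W,W)=g(W,N)=0$. It is known that null curves with $c=0$ in such manifolds are geodesics, so here $c\neq0$.
   Formalization: The printed W is false unless c=1, since it gives g(T,W)=1/c instead of 1; the formal theorem proves W = (-α²c⁴-1)/(2c²) γ' ∓ α φγ' + (1/c) ξ, with τ and N as printed. *)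

theory Defs
  imports "HOL-Analysis.Analysis"
begin

text \<open>
  The derivatives are taken within \<open>S\<close>. For open \<open>S\<close> this is the usual notion; for a
  subset of the real line without isolated points, such as a non-degenerate interval, it gives
  one-sided derivatives at the end points that belong to \<open>S\<close>.
\<close>

primrec C_k_on :: "nat \<Rightarrow> 'a::real_normed_vector set \<Rightarrow> ('a \<Rightarrow> 'b::real_normed_vector) \<Rightarrow> bool" where
  "C_k_on 0 S f = continuous_on S f"
| "C_k_on (Suc k) S f =
     ((\<forall>x\<in>S. f differentiable (at x within S)) \<and>
      (\<forall>v. C_k_on k S (\<lambda>x. frechet_derivative f (at x within S) v)))"

definition smooth_on :: "'a::real_normed_vector set \<Rightarrow> ('a \<Rightarrow> 'b::real_normed_vector) \<Rightarrow> bool" where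
  "smooth_on S f \<longleftrightarrow> (\<forall>k. C_k_on k S f)"


section \<open>Manifolds and tensor fields\<close>

text \<open>
  A chart is a pair of its domain and the coordinate map; the map is relevant on the domain only.
  The manifold is the whole type \<open>'m\<close>, and \<open>A\<close> is an atlas (not necessarily maximal).
\<close>

type_synonym ('m, 'd) chart = "'m set \<times> ('m \<Rightarrow> real ^ 'd)"

definition cdom :: "('m, 'd) chart \<Rightarrow> 'm set" where
  "cdom a = fst a"

definition cmap :: "('m, 'd) chart \<Rightarrow> 'm \<Rightarrow> real ^ 'd" where
  "cmap a = snd a"

definition cinv :: "('m, 'd) chart \<Rightarrow> real ^ 'd \<Rightarrow> 'm" where
  "cinv a = inv_into (cdom a) (cmap a)"

definition transition :: "('m, 'd) chart \<Rightarrow> ('m, 'd) chart \<Rightarrow> real ^ 'd \<Rightarrow> real ^ 'd" where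
  "transition a b = cmap b \<circ> cinv a"

definition smooth_manifold ::
    "('m::{t2_space, second_countable_topology}, 'd::finite) chart set \<Rightarrow> bool" where
  "smooth_manifold A \<longleftrightarrow>
     (\<Union>a\<in>A. cdom a) = UNIV \<and>
     (\<forall>a\<in>A. open (cdom a) \<and> open (cmap a ` cdom a) \<and>
             homeomorphism (cdom a) (cmap a ` cdom a) (cmap a) (cinv a)) \<and>
     (\<forall>a\<in>A. \<forall>b\<in>A. smooth_on (cmap a ` (cdom a \<inter> cdom b)) (transition a b))"

text \<open>
  A tensor or tensor field is given by its components in each chart: \<open>X a p\<close> is the component
  vector at \<open>p\<close>, in the chart \<open>a\<close>, of the vector field \<open>X\<close>. The components in different charts
  are related by the usual transformation laws, where \<open>jac a b p\<close> is the Jacobian at \<open>p\<close> of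
  the change of coordinates from \<open>a\<close> to \<open>b\<close>. Values of \<open>X a p\<close> for \<open>p\<close> outside the domain
  of \<open>a\<close> are irrelevant.
\<close>

definition jac :: "('m, 'd::finite) chart \<Rightarrow> ('m, 'd) chart \<Rightarrow> 'm \<Rightarrow> real ^ 'd \<Rightarrow> real ^ 'd" where
  "jac a b p = frechet_derivative (transition a b) (at (cmap a p))"

text \<open>The second derivative of the change of coordinates.\<close>

definition hess ::
    "('m, 'd::finite) chart \<Rightarrow> ('m, 'd) chart \<Rightarrow> 'm \<Rightarrow> real ^ 'd \<Rightarrow> real ^ 'd \<Rightarrow> real ^ 'd" where
  "hess a b p v w =
     frechet_derivative (\<lambda>x. frechet_derivative (transition a b) (at x) w) (at (cmap a p)) v"

definition smooth_components ::
    "('m, 'd::finite) chart set \<Rightarrow> 'm set \<Rightarrow>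
     (('m, 'd) chart \<Rightarrow> 'm \<Rightarrow> 'b::real_normed_vector) \<Rightarrow> bool" where
  "smooth_components A S F \<longleftrightarrow>
     (\<forall>a\<in>A. smooth_on (cmap a ` (cdom a \<inter> S)) (F a \<circ> cinv a))"

type_synonym ('m, 'd) vfield = "('m, 'd) chart \<Rightarrow> 'm \<Rightarrow> real ^ 'd"
type_synonym ('m, 'd) covfield = "('m, 'd) chart \<Rightarrow> 'm \<Rightarrow> (real ^ 'd) \<Rightarrow>\<^sub>L real"
type_synonym ('m, 'd) endofield = "('m, 'd) chart \<Rightarrow> 'm \<Rightarrow> (real ^ 'd) \<Rightarrow>\<^sub>L (real ^ 'd)"
type_synonym ('m, 'd) bilfield = "('m, 'd) chart \<Rightarrow> 'm \<Rightarrow> (real ^ 'd) \<Rightarrow>\<^sub>L (real ^ 'd) \<Rightarrow>\<^sub>L real"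

definition vector_field_on ::
    "('m, 'd::finite) chart set \<Rightarrow> 'm set \<Rightarrow> ('m, 'd) vfield \<Rightarrow> bool" where
  "vector_field_on A S X \<longleftrightarrow>
     smooth_components A S X \<and>
     (\<forall>a\<in>A. \<forall>b\<in>A. \<forall>p \<in> cdom a \<inter> cdom b \<inter> S. X b p = jac a b p (X a p))"

definition one_form :: "('m, 'd::finite) chart set \<Rightarrow> ('m, 'd) covfield \<Rightarrow> bool" where
  "one_form A \<eta> \<longleftrightarrow>
     smooth_components A UNIV \<eta> \<and>
     (\<forall>a\<in>A. \<forall>b\<in>A. \<forall>p \<in> cdom a \<inter> cdom b. \<forall>v. \<eta> b p (jac a b p v) = \<eta> a p v)"

definition endo_field :: "('m, 'd::finite) chart set \<Rightarrow> ('m, 'd) endofield \<Rightarrow> bool" where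
  "endo_field A \<phi> \<longleftrightarrow>
     smooth_components A UNIV \<phi> \<and>
     (\<forall>a\<in>A. \<forall>b\<in>A. \<forall>p \<in> cdom a \<inter> cdom b. \<forall>v. \<phi> b p (jac a b p v) = jac a b p (\<phi> a p v))"

definition bilinear_field :: "('m, 'd::finite) chart set \<Rightarrow> ('m, 'd) bilfield \<Rightarrow> bool" where
  "bilinear_field A g \<longleftrightarrow>
     smooth_components A UNIV g \<and>
     (\<forall>a\<in>A. \<forall>b\<in>A. \<forall>p \<in> cdom a \<inter> cdom b. \<forall>v w.
        g b p (jac a b p v) (jac a b p w) = g a p v w)"

definition has_signature ::
    "((real ^ 'd::finite) \<Rightarrow>\<^sub>L (real ^ 'd) \<Rightarrow>\<^sub>L real) \<Rightarrow> nat \<Rightarrow> nat \<Rightarrow> bool" where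
  "has_signature B r s \<longleftrightarrow>
     r + s = CARD('d) \<and>
     (\<exists>P Q. subspace P \<and> subspace Q \<and> dim P = r \<and> dim Q = s \<and>
            (\<forall>v\<in>P. v \<noteq> 0 \<longrightarrow> B v v > 0) \<and> (\<forall>w\<in>Q. w \<noteq> 0 \<longrightarrow> B w w < 0) \<and>
            (\<forall>v\<in>P. \<forall>w\<in>Q. B v w = 0))"

definition pseudo_riemannian_metric ::
    "('m, 'd::finite) chart set \<Rightarrow> nat \<Rightarrow> nat \<Rightarrow> ('m, 'd) bilfield \<Rightarrow> bool" where
  "pseudo_riemannian_metric A r s g \<longleftrightarrow>
     bilinear_field A g \<and>
     (\<forall>a\<in>A. \<forall>p\<in>cdom a. (\<forall>v w. g a p v w = g a p w v) \<and> has_signature (g a p) r s)"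


section \<open>Derivations, Lie brackets and the Levi-Civita connection\<close>

text \<open>Derivative at \<open>p\<close>, in the coordinates \<open>a\<close>, in the direction with components \<open>v\<close>.\<close>

definition dir_deriv ::
    "('m, 'd::finite) chart \<Rightarrow> ('m \<Rightarrow> 'b::real_normed_vector) \<Rightarrow> 'm \<Rightarrow> real ^ 'd \<Rightarrow> 'b" where
  "dir_deriv a F p v = frechet_derivative (F \<circ> cinv a) (at (cmap a p)) v"

definition lie_bracket :: "('m, 'd::finite) vfield \<Rightarrow> ('m, 'd) vfield \<Rightarrow> ('m, 'd) vfield" where
  "lie_bracket X Y = (\<lambda>a p. dir_deriv a (Y a) p (X a p) - dir_deriv a (X a) p (Y a p))"

definition app_endo :: "('m, 'd::finite) endofield \<Rightarrow> ('m, 'd) vfield \<Rightarrow> ('m, 'd) vfield" where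
  "app_endo \<phi> X = (\<lambda>a p. \<phi> a p (X a p))"

text \<open>
  An affine connection is given by its connection coefficients (Christoffel symbols):
  \<open>G a p v w\<close> is the bilinear map with coefficients \<open>\<Gamma>\<^sup>k\<^sub>i\<^sub>j\<close> in the chart \<open>a\<close>. The
  transformation law says that \<open>nabla G X Y\<close> is again a vector field.
\<close>

type_synonym ('m, 'd) conn =
  "('m, 'd) chart \<Rightarrow> 'm \<Rightarrow> (real ^ 'd) \<Rightarrow>\<^sub>L (real ^ 'd) \<Rightarrow>\<^sub>L (real ^ 'd)"

definition affine_connection :: "('m, 'd::finite) chart set \<Rightarrow> ('m, 'd) conn \<Rightarrow> bool" where
  "affine_connection A G \<longleftrightarrow>
     smooth_components A UNIV G \<and>
     (\<forall>a\<in>A. \<forall>b\<in>A. \<forall>p \<in> cdom a \<inter> cdom b. \<forall>v w.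
        jac a b p (G a p v w) = hess a b p v w + G b p (jac a b p v) (jac a b p w))"

definition nabla_at ::
    "('m, 'd::finite) conn \<Rightarrow> ('m, 'd) vfield \<Rightarrow> ('m, 'd) chart \<Rightarrow> 'm \<Rightarrow> real ^ 'd \<Rightarrow> real ^ 'd" where
  "nabla_at G Y a p v = dir_deriv a (Y a) p v + G a p v (Y a p)"

definition nabla ::
    "('m, 'd::finite) conn \<Rightarrow> ('m, 'd) vfield \<Rightarrow> ('m, 'd) vfield \<Rightarrow> ('m, 'd) vfield" where
  "nabla G X Y = (\<lambda>a p. nabla_at G Y a p (X a p))"

definition levi_civita ::
    "('m::topological_space, 'd::finite) chart set \<Rightarrow> ('m, 'd) bilfield \<Rightarrow> ('m, 'd) conn \<Rightarrow> bool" where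
  "levi_civita A g G \<longleftrightarrow>
     affine_connection A G \<and>
     (\<forall>S X Y. open S \<and> vector_field_on A S X \<and> vector_field_on A S Y \<longrightarrow>
        (\<forall>a\<in>A. \<forall>p \<in> cdom a \<inter> S. nabla G X Y a p - nabla G Y X a p = lie_bracket X Y a p)) \<and>
     (\<forall>S X Y Z. open S \<and> vector_field_on A S X \<and> vector_field_on A S Y \<and> vector_field_on A S Z \<longrightarrow>
        (\<forall>a\<in>A. \<forall>p \<in> cdom a \<inter> S.
           dir_deriv a (\<lambda>q. g a q (Y a q) (Z a q)) p (X a p) =
             g a p (nabla G X Y a p) (Z a p) + g a p (Y a p) (nabla G X Z a p)))"


section \<open>Almost paracontact metric structures\<close>

definition almost_paracontact ::
    "('m, 'd::finite) chart set \<Rightarrow> nat \<Rightarrow>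
     ('m, 'd) endofield \<Rightarrow> ('m, 'd) vfield \<Rightarrow> ('m, 'd) covfield \<Rightarrow> bool" where
  "almost_paracontact A n \<phi> \<xi> \<eta> \<longleftrightarrow>
     CARD('d) = 2 * n + 1 \<and> endo_field A \<phi> \<and> vector_field_on A UNIV \<xi> \<and> one_form A \<eta> \<and>
     (\<forall>a\<in>A. \<forall>p\<in>cdom a.
        \<eta> a p (\<xi> a p) = 1 \<and>
        (\<forall>v. \<phi> a p (\<phi> a p v) = v - \<eta> a p v *\<^sub>R \<xi> a p) \<and>
        dim {v. \<eta> a p v = 0 \<and> \<phi> a p v = v} = n \<and>
        dim {v. \<eta> a p v = 0 \<and> \<phi> a p v = - v} = n)"

definition almost_paracontact_metric ::
    "('m, 'd::finite) chart set \<Rightarrow> nat \<Rightarrow> ('m, 'd) endofield \<Rightarrow> ('m, 'd) vfield \<Rightarrow>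
     ('m, 'd) covfield \<Rightarrow> ('m, 'd) bilfield \<Rightarrow> bool" where
  "almost_paracontact_metric A n \<phi> \<xi> \<eta> g \<longleftrightarrow>
     almost_paracontact A n \<phi> \<xi> \<eta> \<and>
     pseudo_riemannian_metric A (n + 1) n g \<and>
     (\<forall>a\<in>A. \<forall>p\<in>cdom a. \<forall>v w.
        g a p (\<phi> a p v) (\<phi> a p w) = - g a p v w + \<eta> a p v * \<eta> a p w)"

text \<open>
  Convention for the exterior derivative of a 1-form:
  \<open>d\<eta>(X,Y) = 1/2 (X(\<eta>(Y)) - Y(\<eta>(X)) - \<eta>([X,Y]))\<close>. Without the factor 1/2 the condition
  \<open>[\<phi>,\<phi>] - 2 d\<eta> \<otimes> \<xi> = 0\<close> would force \<open>d\<eta> = 0\<close>.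
\<close>

definition ext_deriv ::
    "('m, 'd::finite) covfield \<Rightarrow> ('m, 'd) vfield \<Rightarrow> ('m, 'd) vfield \<Rightarrow> ('m, 'd) chart \<Rightarrow> 'm \<Rightarrow> real" where
  "ext_deriv \<eta> X Y a p =
     (dir_deriv a (\<lambda>q. \<eta> a q (Y a q)) p (X a p)
      - dir_deriv a (\<lambda>q. \<eta> a q (X a q)) p (Y a p)
      - \<eta> a p (lie_bracket X Y a p)) / 2"

definition nijenhuis ::
    "('m, 'd::finite) endofield \<Rightarrow> ('m, 'd) vfield \<Rightarrow> ('m, 'd) vfield \<Rightarrow> ('m, 'd) vfield" where
  "nijenhuis \<phi> X Y = (\<lambda>a p.
     \<phi> a p (\<phi> a p (lie_bracket X Y a p))
     + lie_bracket (app_endo \<phi> X) (app_endo \<phi> Y) a p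
     - \<phi> a p (lie_bracket (app_endo \<phi> X) Y a p)
     - \<phi> a p (lie_bracket X (app_endo \<phi> Y) a p))"

definition normal ::
    "('m::topological_space, 'd::finite) chart set \<Rightarrow>
     ('m, 'd) endofield \<Rightarrow> ('m, 'd) vfield \<Rightarrow> ('m, 'd) covfield \<Rightarrow> bool" where
  "normal A \<phi> \<xi> \<eta> \<longleftrightarrow>
     (\<forall>S X Y. open S \<and> vector_field_on A S X \<and> vector_field_on A S Y \<longrightarrow>
        (\<forall>a\<in>A. \<forall>p \<in> cdom a \<inter> S.
           nijenhuis \<phi> X Y a p - (2 * ext_deriv \<eta> X Y a p) *\<^sub>R \<xi> a p = 0))"

definition associated_functions ::
    "('m, 'd::finite) chart set \<Rightarrow> ('m, 'd) endofield \<Rightarrow> ('m, 'd) vfield \<Rightarrow> ('m, 'd) conn \<Rightarrow>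
     ('m \<Rightarrow> real) \<Rightarrow> ('m \<Rightarrow> real) \<Rightarrow> bool" where
  "associated_functions A \<phi> \<xi> G \<alpha> \<beta> \<longleftrightarrow>
     (\<forall>a\<in>A. \<forall>p\<in>cdom a.
        2 * \<alpha> p = trace (matrix (\<lambda>v. nabla_at G \<xi> a p v)) \<and>
        2 * \<beta> p = trace (matrix (\<lambda>v. \<phi> a p (nabla_at G \<xi> a p v))))"


section \<open>Curves\<close>

definition curve_dom :: "real set \<Rightarrow> (real \<Rightarrow> 'm) \<Rightarrow> ('m, 'd) chart \<Rightarrow> real set" where
  "curve_dom I \<gamma> a = {t\<in>I. \<gamma> t \<in> cdom a}"

definition smooth_curve ::
    "('m::topological_space, 'd::finite) chart set \<Rightarrow> real set \<Rightarrow> (real \<Rightarrow> 'm) \<Rightarrow> bool" where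
  "smooth_curve A I \<gamma> \<longleftrightarrow>
     is_interval I \<and> interior I \<noteq> {} \<and> continuous_on I \<gamma> \<and>
     (\<forall>a\<in>A. smooth_on (curve_dom I \<gamma> a) (cmap a \<circ> \<gamma>))"

text \<open>Vector fields along a curve, again given by their components in each chart.\<close>

type_synonym ('m, 'd) cfield = "('m, 'd) chart \<Rightarrow> real \<Rightarrow> real ^ 'd"

definition vector_field_along ::
    "('m, 'd::finite) chart set \<Rightarrow> real set \<Rightarrow> (real \<Rightarrow> 'm) \<Rightarrow> ('m, 'd) cfield \<Rightarrow> bool" where
  "vector_field_along A I \<gamma> V \<longleftrightarrow>
     (\<forall>a\<in>A. smooth_on (curve_dom I \<gamma> a) (V a)) \<and>
     (\<forall>a\<in>A. \<forall>b\<in>A. \<forall>t \<in> curve_dom I \<gamma> a \<inter> curve_dom I \<gamma> b.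
        V b t = jac a b (\<gamma> t) (V a t))"

definition velocity :: "real set \<Rightarrow> (real \<Rightarrow> 'm) \<Rightarrow> ('m, 'd::finite) cfield" where
  "velocity I \<gamma> = (\<lambda>a t. vector_derivative (cmap a \<circ> \<gamma>) (at t within I))"

text \<open>The covariant derivative \<open>\<nabla>\<^bsub>\<gamma>'\<^esub> V\<close> of a vector field \<open>V\<close> along the curve \<open>\<gamma>\<close>.\<close>

definition cov_deriv ::
    "real set \<Rightarrow> (real \<Rightarrow> 'm) \<Rightarrow> ('m, 'd::finite) conn \<Rightarrow> ('m, 'd) cfield \<Rightarrow> ('m, 'd) cfield" where
  "cov_deriv I \<gamma> G V = (\<lambda>a t.
     vector_derivative (V a) (at t within I) + G a (\<gamma> t) (velocity I \<gamma> a t) (V a t))"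

definition null_curve ::
    "('m, 'd::finite) chart set \<Rightarrow> ('m, 'd) bilfield \<Rightarrow> real set \<Rightarrow> (real \<Rightarrow> 'm) \<Rightarrow> bool" where
  "null_curve A g I \<gamma> \<longleftrightarrow>
     (\<forall>a\<in>A. \<forall>t \<in> curve_dom I \<gamma> a. g a (\<gamma> t) (velocity I \<gamma> a t) (velocity I \<gamma> a t) = 0)"

definition slant_curve ::
    "('m, 'd::finite) chart set \<Rightarrow> ('m, 'd) covfield \<Rightarrow> real set \<Rightarrow> (real \<Rightarrow> 'm) \<Rightarrow> real \<Rightarrow> bool" where
  "slant_curve A \<eta> I \<gamma> c \<longleftrightarrow>
     (\<forall>a\<in>A. \<forall>t \<in> curve_dom I \<gamma> a. \<eta> a (\<gamma> t) (velocity I \<gamma> a t) = c)"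

definition geodesic ::
    "('m, 'd::finite) chart set \<Rightarrow> ('m, 'd) conn \<Rightarrow> real set \<Rightarrow> (real \<Rightarrow> 'm) \<Rightarrow> bool" where
  "geodesic A G I \<gamma> \<longleftrightarrow>
     (\<forall>a\<in>A. \<forall>t \<in> curve_dom I \<gamma> a. cov_deriv I \<gamma> G (velocity I \<gamma>) a t = 0)"

definition unit_acceleration ::
    "('m, 'd::finite) chart set \<Rightarrow> ('m, 'd) bilfield \<Rightarrow> ('m, 'd) conn \<Rightarrow>
     real set \<Rightarrow> (real \<Rightarrow> 'm) \<Rightarrow> bool" where
  "unit_acceleration A g G I \<gamma> \<longleftrightarrow>
     (\<forall>a\<in>A. \<forall>t \<in> curve_dom I \<gamma> a.
        g a (\<gamma> t) (cov_deriv I \<gamma> G (velocity I \<gamma>) a t) (cov_deriv I \<gamma> G (velocity I \<gamma>) a t) = 1)"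

text \<open>
  The function \<open>\<tau>\<close> and the vector fields \<open>N\<close>, \<open>W\<close> of the Cartan frame; the first vector field
  of the frame is \<open>velocity I \<gamma>\<close>.

  Pitfall: the coefficients \<open>- (\<alpha>\<^sup>2 c\<^sup>2 + 1) / (2 c)\<close> of \<open>\<gamma>'\<close> and \<open>1 / c\<^sup>2\<close> of
  \<open>\<xi>\<close> printed in the source for \<open>W\<close> contradict \<open>g(\<gamma>', W) = 1\<close> unless \<open>c = 1\<close>; the
  definition of \<open>W\<close> gives \<open>- (\<alpha>\<^sup>2 c\<^sup>4 + 1) / (2 c\<^sup>2)\<close> and \<open>1 / c\<close>.
\<close>

definition cartan_frame ::
    "('m, 'd::finite) chart set \<Rightarrow> ('m, 'd) bilfield \<Rightarrow> ('m, 'd) conn \<Rightarrow>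
     real set \<Rightarrow> (real \<Rightarrow> 'm) \<Rightarrow> (real \<Rightarrow> real) \<Rightarrow> ('m, 'd) cfield \<Rightarrow> ('m, 'd) cfield \<Rightarrow> bool" where
  "cartan_frame A g G I \<gamma> \<tau> N W \<longleftrightarrow>
     vector_field_along A I \<gamma> N \<and> vector_field_along A I \<gamma> W \<and>
     (\<forall>a\<in>A. \<forall>t \<in> curve_dom I \<gamma> a.
        N a t = cov_deriv I \<gamma> G (velocity I \<gamma>) a t \<and>
        \<tau> t = g a (\<gamma> t) (cov_deriv I \<gamma> G N a t) (cov_deriv I \<gamma> G N a t) / 2 \<and>
        W a t = - cov_deriv I \<gamma> G N a t - \<tau> t *\<^sub>R velocity I \<gamma> a t)"

end

theory Submission
  imports Defs
begin

text \<open>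
  Write \<open>T\<close> for the velocity. The idea is that, as long as \<open>c \<noteq> 0\<close>, the vectors
  \<open>T, \<phi>T, \<xi>\<close> form a basis of the tangent space with a known Gram matrix. So \<open>N = \<nabla>\<^sub>T T\<close> and
  \<open>\<nabla>\<^sub>T N\<close> are determined by their inner products with this basis, and these are obtained by
  differentiating scalar identities along the curve. The derivative of \<open>g(T,T) = 0\<close> gives
  \<open>g(N,T) = 0\<close>, that of \<open>g(T,\<xi>) = c\<close> gives \<open>\<eta>(N) = \<alpha>c\<^sup>2\<close>, and then \<open>g(N,N) = 1\<close> leaves only a
  sign for the component of \<open>N\<close> along \<open>\<phi>T\<close> (\<open>N_expansion\<close>). The derivatives of
  \<open>g(N,T) = 0\<close>, \<open>g(N,N) = 1\<close> and \<open>g(N,\<xi>) = \<alpha>c\<^sup>2\<close> give \<open>\<nabla>\<^sub>T N\<close> in the same way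
  (\<open>DN_expansion\<close>), and \<open>\<tau>\<close> and \<open>W\<close> follow. The sign is continuous, so it is the same
  along the whole curve (\<open>frame_sign_constant\<close>), and \<open>c = 0\<close> is impossible because the plane
  orthogonal to \<open>\<xi>\<close> is too small to contain both \<open>T\<close> and \<open>N\<close> (\<open>c_nonzero\<close>).

  Normality enters through the formula
  \<open>\<nabla>\<^sub>X \<xi> = \<alpha>(X - \<eta>(X)\<xi>) + \<beta>\<phi>X\<close> (\<open>nabla_xi\<close>), which is what the derivative of an
  inner product with \<open>\<xi>\<close> involves. To obtain it, the normality tensor is evaluated on a
  coordinate field and \<open>\<xi>\<close>. Its \<open>\<xi>\<close>-component gives \<open>\<nabla>\<^sub>\<xi> \<xi> = 0\<close>. For an eigenvector \<open>v\<close> of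
  \<open>\<phi>\<close> orthogonal to \<open>\<xi>\<close> its inner product with \<open>v\<close> gives \<open>g(\<nabla>\<^sub>v \<xi>, v) = 0\<close>. Since the
  two eigenlines of \<open>\<phi>\<close> in the plane orthogonal to \<open>\<xi>\<close> are null and dual to each other,
  \<open>\<nabla>\<xi>\<close> preserves both, so it is a combination of the identity of that plane and \<open>\<phi>\<close>, with
  coefficients read off from traces (\<open>diagonal_operator\<close>).

  The coordinate fields must be smooth in every chart, which requires the chain rule for maps of
  class \<open>C\<^sup>k\<close> (\<open>C_k_on_compose\<close>).
\<close>

section \<open>Differentiability of finite order\<close>

lemma C_k_on_cong:
  assumes "\<And>x. x \<in> S \<Longrightarrow> f x = g x"
  shows "C_k_on k S f \<longleftrightarrow> C_k_on k S g"
  using assms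
proof (induction k arbitrary: f g)
  case 0
  then show ?case by (simp cong: continuous_on_cong)
next
  case (Suc k)
  have eq: "(f has_derivative D) (at x within S) \<longleftrightarrow> (g has_derivative D) (at x within S)"
    if "x \<in> S" for x D
    using that Suc.prems has_derivative_transform[of x S f g D] has_derivative_transform[of x S g f D] by metis
  have "f differentiable (at x within S) \<longleftrightarrow> g differentiable (at x within S)"
    and "frechet_derivative f (at x within S) = frechet_derivative g (at x within S)"
    if "x \<in> S" for x
    using eq[OF that] by (simp_all add: differentiable_def frechet_derivative_def)
  then show ?case
    using Suc.IH[of "\<lambda>x. frechet_derivative f (at x within S) v" "\<lambda>x. frechet_derivative g (at x within S) v" for v] by simp
qed

text \<open>
  On an open set the derivative is unique, so any family of derivatives may be used in place of
  the one picked by \<^const>\<open>frechet_derivative\<close>.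
\<close>

lemma C_k_on_Suc_iff:
  assumes "open S"
  shows "C_k_on (Suc k) S f \<longleftrightarrow>
    (\<exists>D. (\<forall>x\<in>S. (f has_derivative D x) (at x)) \<and> (\<forall>v. C_k_on k S (\<lambda>x. D x v)))"
    (is "?L \<longleftrightarrow> ?R")
proof
  assume ?L
  then show ?R
    by (intro exI[of _ "\<lambda>x. frechet_derivative f (at x within S)"])
      (auto simp: at_within_open[OF _ assms] frechet_derivative_works)
next
  assume ?R
  then obtain D where D: "\<And>x. x \<in> S \<Longrightarrow> (f has_derivative D x) (at x)"
    and C: "\<And>v. C_k_on k S (\<lambda>x. D x v)" by blast
  have "frechet_derivative f (at x within S) = D x" if "x \<in> S" for x
    using frechet_derivative_at[OF D[OF that]] at_within_open[OF that assms] by simp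
  then have "C_k_on k S (\<lambda>x. frechet_derivative f (at x within S) v)" for v
    using C[of v] by (simp cong: C_k_on_cong)
  moreover have "f differentiable (at x within S)" if "x \<in> S" for x
    using D[OF that] by (auto simp: differentiable_def intro: has_derivative_at_withinI)
  ultimately show ?L by simp
qed

lemma C_k_on_SucI:
  assumes "open S" "\<And>x. x \<in> S \<Longrightarrow> (f has_derivative D x) (at x)"
    and "\<And>v. C_k_on k S (\<lambda>x. D x v)"
  shows "C_k_on (Suc k) S f"
  using assms by (auto simp only: C_k_on_Suc_iff[OF assms(1)])

lemma C_k_on_SucE:
  assumes "C_k_on (Suc k) S f" "open S"
  obtains D where "\<And>x. x \<in> S \<Longrightarrow> (f has_derivative D x) (at x)"
    and "\<And>v. C_k_on k S (\<lambda>x. D x v)"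
  using assms by (metis C_k_on_Suc_iff)

lemma C_k_on_SucD: "C_k_on (Suc k) S f \<Longrightarrow> C_k_on k S f"
proof (induction k arbitrary: f)
  case 0
  then show ?case
    by (auto simp: continuous_on_eq_continuous_within intro: differentiable_imp_continuous_within)
next
  case (Suc k)
  have "C_k_on (Suc k) S (\<lambda>x. frechet_derivative f (at x within S) v)" for v
    using Suc.prems by simp
  then show ?case using Suc.IH Suc.prems by simp
qed

lemma C_k_on_open_subset:
  assumes "C_k_on k T f" "open S" "open T" "S \<subseteq> T"
  shows "C_k_on k S f"
  using assms(1)
proof (induction k arbitrary: f)
  case 0
  then show ?case using assms(4) continuous_on_subset by auto
next
  case (Suc k)
  from Suc.prems obtain D where "\<And>x. x \<in> T \<Longrightarrow> (f has_derivative D x) (at x)"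
    and "\<And>v. C_k_on k T (\<lambda>x. D x v)" using C_k_on_SucE assms(3) by metis
  then show ?case using Suc.IH assms by (intro C_k_on_SucI[where D = D]) auto
qed

lemma C_k_on_const: "open S \<Longrightarrow> C_k_on k S (\<lambda>x. c)"
  by (induction k arbitrary: c) (auto intro!: C_k_on_SucI[where D = "\<lambda>x v. 0"] simp del: C_k_on.simps(2))

lemma C_k_on_add:
  assumes "open S" "C_k_on k S f" "C_k_on k S g"
  shows "C_k_on k S (\<lambda>x. f x + g x)"
  using assms(2,3)
proof (induction k arbitrary: f g)
  case 0
  then show ?case by (simp add: continuous_on_add)
next
  case (Suc k)
  from Suc.prems(1) obtain D where D: "\<And>x. x \<in> S \<Longrightarrow> (f has_derivative D x) (at x)"
    "\<And>v. C_k_on k S (\<lambda>x. D x v)" using C_k_on_SucE assms(1) by metis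
  from Suc.prems(2) obtain E where E: "\<And>x. x \<in> S \<Longrightarrow> (g has_derivative E x) (at x)"
    "\<And>v. C_k_on k S (\<lambda>x. E x v)" using C_k_on_SucE assms(1) by metis
  show ?case
    using D E Suc.IH assms(1)
    by (intro C_k_on_SucI[where D = "\<lambda>x v. D x v + E x v"]) (auto intro: has_derivative_add)
qed

lemma C_k_on_sum:
  assumes "open S" "finite B" "\<And>b. b \<in> B \<Longrightarrow> C_k_on k S (f b)"
  shows "C_k_on k S (\<lambda>x. \<Sum>b\<in>B. f b x)"
  using assms(2,3) by (induction B) (auto intro: C_k_on_const C_k_on_add assms(1))

lemma C_k_on_scaleR:
  fixes f :: "'a::real_normed_vector \<Rightarrow> real"
  assumes "open S" "C_k_on k S f" "C_k_on k S g"
  shows "C_k_on k S (\<lambda>x. f x *\<^sub>R g x)"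
  using assms(2,3)
proof (induction k arbitrary: f g)
  case 0
  then show ?case by (simp add: continuous_on_scaleR)
next
  case (Suc k)
  from Suc.prems(1) obtain D where D: "\<And>x. x \<in> S \<Longrightarrow> (f has_derivative D x) (at x)"
    "\<And>v. C_k_on k S (\<lambda>x. D x v)" using C_k_on_SucE assms(1) by metis
  from Suc.prems(2) obtain E where E: "\<And>x. x \<in> S \<Longrightarrow> (g has_derivative E x) (at x)"
    "\<And>v. C_k_on k S (\<lambda>x. E x v)" using C_k_on_SucE assms(1) by metis
  show ?case
    using D E Suc.IH assms(1) C_k_on_SucD[OF Suc.prems(1)] C_k_on_SucD[OF Suc.prems(2)]
    by (intro C_k_on_SucI[where D = "\<lambda>x v. f x *\<^sub>R E x v + D x v *\<^sub>R g x"])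
      (auto intro!: has_derivative_scaleR C_k_on_add)
qed

lemma C_k_on_bounded_linear:
  assumes "open S" "bounded_linear L" "C_k_on k S f"
  shows "C_k_on k S (\<lambda>x. L (f x))"
  using assms(3)
proof (induction k arbitrary: f)
  case 0
  then show ?case using assms(2) by (auto intro: bounded_linear.continuous_on)
next
  case (Suc k)
  from Suc.prems obtain D where D: "\<And>x. x \<in> S \<Longrightarrow> (f has_derivative D x) (at x)"
    "\<And>v. C_k_on k S (\<lambda>x. D x v)" using C_k_on_SucE assms(1) by metis
  show ?case
    using D Suc.IH assms
    by (intro C_k_on_SucI[where D = "\<lambda>x v. L (D x v)"]) (auto intro: bounded_linear.has_derivative)
qed

text \<open>
  The chain rule gives the derivative of a composition in direction \<open>v\<close> as
  \<open>\<Sum>\<^sub>b (Dh v)\<^sub>b (\<partial>\<^sub>b f \<circ> h)\<close>, which is of the form covered by the induction hypothesis.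
\<close>

lemma C_k_on_compose:
  fixes h :: "'a::real_normed_vector \<Rightarrow> 'b::euclidean_space"
  assumes "open S" "open T" "h ` S \<subseteq> T" "C_k_on k T f" "C_k_on k S h"
  shows "C_k_on k S (\<lambda>x. f (h x))"
  using assms(4,5)
proof (induction k arbitrary: f)
  case 0
  then show ?case using assms(3) by (auto intro: continuous_on_compose2)
next
  case (Suc k)
  from Suc.prems(1) obtain D where D: "\<And>x. x \<in> T \<Longrightarrow> (f has_derivative D x) (at x)"
    "\<And>v. C_k_on k T (\<lambda>x. D x v)" using C_k_on_SucE assms(2) by metis
  from Suc.prems(2) obtain E where E: "\<And>x. x \<in> S \<Longrightarrow> (h has_derivative E x) (at x)"
    "\<And>v. C_k_on k S (\<lambda>x. E x v)" using C_k_on_SucE assms(1) by metis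
  show ?case
  proof (rule C_k_on_SucI[OF assms(1), where D = "\<lambda>x v. D (h x) (E x v)"])
    show "((\<lambda>x. f (h x)) has_derivative (\<lambda>v. D (h x) (E x v))) (at x)" if "x \<in> S" for x
      using has_derivative_compose[OF E(1)[OF that] D(1)] assms(3) that by auto
    have "D (h x) (E x v) = (\<Sum>b\<in>Basis. (E x v \<bullet> b) *\<^sub>R D (h x) b)" if "x \<in> S" for x v
    proof -
      interpret linear "D (h x)"
        using D(1)[of "h x"] assms(3) that by (auto intro: has_derivative_linear)
      have "D (h x) (E x v) = D (h x) (\<Sum>b\<in>Basis. (E x v \<bullet> b) *\<^sub>R b)"
        by (simp add: euclidean_representation)
      then show ?thesis by (simp add: sum scale)
    qed
    moreover have "C_k_on k S (\<lambda>x. \<Sum>b\<in>Basis. (E x v \<bullet> b) *\<^sub>R D (h x) b)" for v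
      using D(2) E(2) Suc.IH C_k_on_SucD[OF Suc.prems(2)] assms(1)
      by (auto intro!: C_k_on_sum C_k_on_scaleR C_k_on_bounded_linear[OF _ bounded_linear_inner_left])
    ultimately show "C_k_on k S (\<lambda>x. D (h x) (E x v))" for v
      by (simp cong: C_k_on_cong)
  qed
qed

section \<open>Linear algebra of a three-dimensional paracontact metric space\<close>

lemma signature_nondegenerate:
  fixes B :: "(real ^ 'd::finite) \<Rightarrow>\<^sub>L (real ^ 'd) \<Rightarrow>\<^sub>L real"
  assumes "has_signature B r s" and orth: "\<And>w. B v w = 0"
  shows "v = 0"
proof -
  from assms(1) obtain P Q where sub: "subspace P" "subspace Q"
    and dims: "dim P + dim Q = CARD('d)"
    and pos: "\<And>v. v \<in> P \<Longrightarrow> v \<noteq> 0 \<Longrightarrow> B v v > 0"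
    and neg: "\<And>w. w \<in> Q \<Longrightarrow> w \<noteq> 0 \<Longrightarrow> B w w < 0"
    and PQ: "\<And>v w. v \<in> P \<Longrightarrow> w \<in> Q \<Longrightarrow> B v w = 0"
    unfolding has_signature_def by metis
  have "P \<inter> Q = {0}"
    using pos neg sub[THEN subspace_0] by (force simp: set_eq_iff)
  then have "dim (P \<inter> Q) = 0" by simp
  moreover define U where "U = {x + y |x y. x \<in> P \<and> y \<in> Q}"
  ultimately have "dim U = CARD('d)"
    unfolding U_def using dim_sums_Int[OF sub] dims by linarith
  then have "span U = UNIV" using dim_eq_full[of U] by simp
  moreover have "span U = U" using subspace_sums[OF sub] by (simp add: span_eq_iff U_def)
  ultimately have "U = UNIV" by metis
  then have "v \<in> U" by simp
  then obtain x y where xy: "x \<in> P" "y \<in> Q" "v = x + y" unfolding U_def by blast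
  have "y = 0"
    using orth[of y] PQ[of x y] neg[of y] xy by (force simp: blinfun.bilinear_simps)
  moreover have "x = 0"
    using orth[of x] pos[of x] xy calculation by (force simp: blinfun.bilinear_simps)
  ultimately show ?thesis using xy by simp
qed

text \<open>
  Writing an endomorphism as a sum of rank one maps gives its trace without a change of basis.
\<close>

lemma trace_rank_one:
  fixes l :: "real ^ 'n::finite \<Rightarrow> real"
  assumes "linear l"
  shows "trace (matrix (\<lambda>v. l v *\<^sub>R u)) = l u"
proof -
  interpret linear l by fact
  have "l u = l (\<Sum>i\<in>UNIV. (u $ i) *\<^sub>R axis i 1)"
    by (simp add: scalar_mult_eq_scaleR[symmetric] basis_expansion)
  then show ?thesis
    by (simp add: sum scale trace_def matrix_def mult.commute)
qed

lemma trace_matrix_add: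
  "trace (matrix (\<lambda>v. f v + h v)) = trace (matrix f) + trace (matrix h)"
  for f h :: "real ^ 'n::finite \<Rightarrow> real ^ 'n"
  by (simp add: trace_def matrix_def sum.distrib)

lemma dim_one_multiples:
  fixes S :: "'a::euclidean_space set"
  assumes "subspace S" "dim S = 1"
  obtains e where "e \<in> S" "e \<noteq> 0" "\<And>v. v \<in> S \<Longrightarrow> \<exists>k. v = k *\<^sub>R e"
proof -
  obtain B where B: "B \<subseteq> S" "independent B" "S \<subseteq> span B" "card B = dim S"
    using basis_exists by blast
  from B(4) assms(2) obtain e where e: "B = {e}" using card_1_singletonE by metis
  show ?thesis
  proof
    show "e \<in> S" using B e by auto
    show "e \<noteq> 0" using B e dependent_zero by auto
    show "\<exists>k. v = k *\<^sub>R e" if "v \<in> S" for v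
      using B(3) e that by (auto simp: span_singleton)
  qed
qed

text \<open>
  The structure that an almost paracontact metric structure puts on a tangent space: \<open>P\<close>, \<open>z\<close>
  and \<open>e\<close> stand for the values of \<open>\<phi>\<close>, \<open>\<xi>\<close> and \<open>\<eta>\<close>.
\<close>

locale paracontact_metric_space =
  fixes P :: "(real ^ 3) \<Rightarrow>\<^sub>L (real ^ 3)" and z :: "real ^ 3"
    and e :: "(real ^ 3) \<Rightarrow>\<^sub>L real" and g :: "(real ^ 3) \<Rightarrow>\<^sub>L (real ^ 3) \<Rightarrow>\<^sub>L real"
  assumes e_z: "e z = 1"
    and P_P: "P (P v) = v - e v *\<^sub>R z"
    and dim_plus: "dim {v. e v = 0 \<and> P v = v} = 1"
    and dim_minus: "dim {v. e v = 0 \<and> P v = - v} = 1"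
    and sym: "g v w = g w v"
    and nondegenerate: "(\<And>w. g v w = 0) \<Longrightarrow> v = 0"
    and g_P_P: "g (P v) (P w) = - g v w + e v * e w"
begin

lemma z_nonzero: "z \<noteq> 0"
  using e_z by auto

text \<open>Both identities come from computing \<open>P\<^sup>3\<close> in two ways.\<close>

lemma P_z: "P z = 0" and e_P: "e (P v) = 0"
proof -
  have *: "e v *\<^sub>R P z = e (P v) *\<^sub>R z" for v
    using P_P[of "P v"] arg_cong[OF P_P[of v], of "\<lambda>v. P v"] by (simp add: blinfun.bilinear_simps)
  have Pz: "P z = e (P z) *\<^sub>R z" using *[of z] e_z by simp
  have "0 = P (P z)" using P_P[of z] e_z by simp
  also have "\<dots> = e (P z) *\<^sub>R P z" by (subst Pz) (simp add: blinfun.bilinear_simps)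
  finally show "P z = 0" using Pz by auto
  then show "e (P v) = 0" using *[of v] z_nonzero by simp
qed

lemma g_z [simp]: "g v z = e v" "g z v = e v"
  using g_P_P[of v z] by (simp_all add: P_z e_z sym[of z v])

lemma g_P_skew: "g (P v) w = - g v (P w)"
  using g_P_P[of v "P w"] by (simp add: P_P e_P blinfun.bilinear_simps)

lemma g_P_self: "g (P v) v = 0" "g v (P v) = 0"
  using g_P_skew[of v v] sym[of v "P v"] by auto

text \<open>
  The eigenvectors of \<open>P\<close> on the kernel of \<open>e\<close> are null because \<open>P\<close> is an anti-isometry
  there, and they are not orthogonal because the metric is nondegenerate. So the coordinates of a
  vector with respect to \<open>z, u, w\<close> can be read off from inner products.
\<close>

lemma eigenbasis:
  obtains u w where "P u = u" "P w = - w" "e u = 0" "e w = 0"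
    and "g u u = 0" "g w w = 0" "g u w \<noteq> 0"
    and "\<And>v. v = e v *\<^sub>R z + (g v w / g u w) *\<^sub>R u + (g v u / g u w) *\<^sub>R w"
proof -
  let ?plus = "{v. e v = 0 \<and> P v = v}" and ?minus = "{v. e v = 0 \<and> P v = - v}"
  have sub: "subspace ?plus" "subspace ?minus"
    by (auto simp: subspace_def blinfun.bilinear_simps)
  obtain u where "u \<in> ?plus" "u \<noteq> 0" "\<And>v. v \<in> ?plus \<Longrightarrow> \<exists>k. v = k *\<^sub>R u"
    by (rule dim_one_multiples[OF sub(1) dim_plus], rule that)
  then have u: "e u = 0" "P u = u" "u \<noteq> 0" "\<And>v. e v = 0 \<Longrightarrow> P v = v \<Longrightarrow> \<exists>k. v = k *\<^sub>R u"
    by simp_all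
  obtain w where "w \<in> ?minus" "w \<noteq> 0" "\<And>v. v \<in> ?minus \<Longrightarrow> \<exists>k. v = k *\<^sub>R w"
    by (rule dim_one_multiples[OF sub(2) dim_minus], rule that)
  then have w: "e w = 0" "P w = - w" "w \<noteq> 0" "\<And>v. e v = 0 \<Longrightarrow> P v = - v \<Longrightarrow> \<exists>k. v = k *\<^sub>R w"
    by simp_all
  have null: "g u u = 0" "g w w = 0"
    using g_P_P[of u u] g_P_P[of w w] u w by (simp_all add: blinfun.bilinear_simps)
  have ex: "\<exists>x y. v = e v *\<^sub>R z + x *\<^sub>R u + y *\<^sub>R w" for v
  proof -
    define r where "r = v - e v *\<^sub>R z"
    have r: "e r = 0" "P (P r) = r" by (simp_all add: r_def P_P e_z blinfun.bilinear_simps)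
    obtain x y where "(1/2) *\<^sub>R (r + P r) = x *\<^sub>R u" "(1/2) *\<^sub>R (r - P r) = y *\<^sub>R w"
      using u(4)[of "(1/2) *\<^sub>R (r + P r)"] w(4)[of "(1/2) *\<^sub>R (r - P r)"] r
      by (auto simp: e_P blinfun.bilinear_simps algebra_simps)
    moreover have "r = (1/2) *\<^sub>R (r + P r) + (1/2) *\<^sub>R (r - P r)"
      by (simp add: algebra_simps flip: scaleR_add_left)
    ultimately have "r = x *\<^sub>R u + y *\<^sub>R w" by metis
    then have "v = e v *\<^sub>R z + x *\<^sub>R u + y *\<^sub>R w"
      unfolding r_def by (simp add: algebra_simps)
    then show ?thesis by blast
  qed
  have E: "g u w \<noteq> 0"
  proof
    assume 0: "g u w = 0"
    have "g u v = 0" for v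
    proof -
      obtain x y where "v = e v *\<^sub>R z + x *\<^sub>R u + y *\<^sub>R w" using ex by blast
      then have "g u v = g u (e v *\<^sub>R z + x *\<^sub>R u + y *\<^sub>R w)" by simp
      then show ?thesis using 0 null u by (simp add: blinfun.bilinear_simps)
    qed
    then show False using nondegenerate u by blast
  qed
  show ?thesis
  proof (rule that[OF u(2) w(2) u(1) w(1) null E])
    fix v
    obtain x y where v: "v = e v *\<^sub>R z + x *\<^sub>R u + y *\<^sub>R w" using ex by blast
    have "g v w = g (e v *\<^sub>R z + x *\<^sub>R u + y *\<^sub>R w) w"
         "g v u = g (e v *\<^sub>R z + x *\<^sub>R u + y *\<^sub>R w) u" using v by simp_all
    then have "g v w = x * g u w" "g v u = y * g u w"
      using null u w sym[of w u] by (simp_all add: blinfun.bilinear_simps)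
    then show "v = e v *\<^sub>R z + (g v w / g u w) *\<^sub>R u + (g v u / g u w) *\<^sub>R w"
      using E v by simp
  qed
qed

text \<open>
  An eigenvector \<open>v\<close> of \<open>P\<close> spans its own orthogonal complement in the kernel of \<open>e\<close>. So
  the hypotheses make \<open>h\<close> diagonal in the eigenbasis, that is, a combination of the
  projection to that kernel and of \<open>P\<close>; the two coefficients are found by taking traces.
\<close>

lemma diagonal_operator:
  assumes "linear h" and hz: "h z = 0" and eh: "\<And>v. e (h v) = 0"
    and orth: "\<And>v s. s \<in> {1, -1} \<Longrightarrow> e v = 0 \<Longrightarrow> P v = s *\<^sub>R v \<Longrightarrow> g (h v) v = 0"
  shows "h v = (trace (matrix h) / 2) *\<^sub>R (v - e v *\<^sub>R z)
             + (trace (matrix (\<lambda>v. P (h v))) / 2) *\<^sub>R P v"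
proof -
  interpret h: linear h by fact
  obtain u w where uw: "P u = u" "P w = - w" "e u = 0" "e w = 0"
    and null: "g u u = 0" "g w w = 0" and E: "g u w \<noteq> 0"
    and dec: "\<And>v. v = e v *\<^sub>R z + (g v w / g u w) *\<^sub>R u + (g v u / g u w) *\<^sub>R w"
    by (rule eigenbasis, rule that)
  define k where "k = g (h u) w / g u w"
  define l where "l = g (h w) u / g u w"
  have hu: "h u = k *\<^sub>R u"
    using dec[of "h u"] orth[of 1 u] uw eh by (simp add: k_def)
  have hw: "h w = l *\<^sub>R w"
    using dec[of "h w"] orth[of "-1" w] uw eh by (simp add: l_def)
  have h: "h v = (k * g v w / g u w) *\<^sub>R u + (l * g v u / g u w) *\<^sub>R w" for v
    by (subst dec[of v]) (simp add: h.add h.scale hz hu hw mult.commute)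
  have Ph: "P (h v) = (k * g v w / g u w) *\<^sub>R u + (- l * g v u / g u w) *\<^sub>R w" for v
    by (subst h) (simp add: uw blinfun.bilinear_simps)
  have lin: "linear (\<lambda>v. a * g v b / g u w)" for a b
    by (intro linearI) (simp_all add: blinfun.bilinear_simps algebra_simps add_divide_distrib)
  have tr: "trace (matrix h) = k + l"
    unfolding h[abs_def] using E by (simp add: trace_matrix_add trace_rank_one lin sym[of w u])
  have trP: "trace (matrix (\<lambda>v. P (h v))) = k - l"
    unfolding Ph trace_matrix_add trace_rank_one[OF lin] using E by (simp add: sym[of w u])
  define x where "x = g v w / g u w"
  define y where "y = g v u / g u w"
  have v: "v = e v *\<^sub>R z + x *\<^sub>R u + y *\<^sub>R w" using dec[of v] unfolding x_def y_def .
  then have v_z: "v - e v *\<^sub>R z = x *\<^sub>R u + y *\<^sub>R w" by (simp add: diff_eq_eq add_ac)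
  have Pv: "P v = x *\<^sub>R u - y *\<^sub>R w"
    by (subst v) (simp add: uw P_z blinfun.bilinear_simps)
  have "h v = (k * x) *\<^sub>R u + (l * y) *\<^sub>R w"
    using h[of v] unfolding x_def y_def by simp
  also have "\<dots> = ((k + l) / 2) *\<^sub>R (x *\<^sub>R u + y *\<^sub>R w) + ((k - l) / 2) *\<^sub>R (x *\<^sub>R u - y *\<^sub>R w)"
    by (simp add: vec_eq_iff field_simps)
  finally have "h v = ((k + l) / 2) *\<^sub>R (v - e v *\<^sub>R z) + ((k - l) / 2) *\<^sub>R P v"
    unfolding v_z Pv .
  then show ?thesis unfolding tr trP by simp
qed

text \<open>
  With \<open>T = c z + p u + q w\<close> in the eigenbasis, where \<open>c = e T\<close>, nullity of \<open>T\<close> says \<open>2 p q g(u,w) = -c\<^sup>2\<close>,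
  so \<open>p\<close> and \<open>q\<close> are nonzero and \<open>T \<plusminus> P T\<close> together with \<open>z\<close> span the space.
\<close>

lemma null_frame_complete:
  assumes "g T T = 0" "e T \<noteq> 0" and R: "e R = 0" "g R T = 0" "g R (P T) = 0"
  shows "R = 0"
proof -
  obtain u w where uw: "P u = u" "P w = - w" "e u = 0" "e w = 0"
    and null: "g u u = 0" "g w w = 0" and E: "g u w \<noteq> 0"
    and dec: "\<And>v. v = e v *\<^sub>R z + (g v w / g u w) *\<^sub>R u + (g v u / g u w) *\<^sub>R w"
    by (rule eigenbasis, rule that)
  define p where "p = g T w / g u w"
  define q where "q = g T u / g u w"
  have T: "T = e T *\<^sub>R z + p *\<^sub>R u + q *\<^sub>R w" using dec[of T] unfolding p_def q_def .
  have PT: "P T = p *\<^sub>R u - q *\<^sub>R w"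
    by (subst T) (simp add: uw P_z blinfun.bilinear_simps)
  have "g T T = g T (e T *\<^sub>R z + p *\<^sub>R u + q *\<^sub>R w)" using T by (rule arg_cong)
  then have "e T * e T + p * g T u + q * g T w = 0"
    using assms(1) by (simp add: blinfun.bilinear_simps)
  then have pq: "p \<noteq> 0" "q \<noteq> 0" using assms(2) E by (auto simp: p_def q_def)
  have "g R T = g R (e T *\<^sub>R z + p *\<^sub>R u + q *\<^sub>R w)" using T by (rule arg_cong)
  then have "p * g R u + q * g R w = 0" using R by (simp add: blinfun.bilinear_simps)
  moreover have "p * g R u - q * g R w = 0" using R(3) by (simp add: PT blinfun.bilinear_simps)
  ultimately have "p * g R u = 0" "q * g R w = 0" by linarith+
  then have "g R u = 0" "g R w = 0" using pq by auto
  then show ?thesis using dec[of R] R(1) by simp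
qed

text \<open>
  The Gram matrix of \<open>T, P T, z\<close> has \<open>g(T,z) = c\<close>, \<open>g(PT,PT) = c\<^sup>2\<close>, \<open>g(z,z) = 1\<close> as its only
  nonzero entries up to symmetry. Inverting it gives the coefficients.
\<close>

lemma null_frame_expansion:
  assumes "g T T = 0" "e T = c" "c \<noteq> 0"
  shows "V = ((e V - g V T / c) / c) *\<^sub>R T + (g V (P T) / c\<^sup>2) *\<^sub>R P T + (g V T / c) *\<^sub>R z"
proof -
  define x where "x = (e V - g V T / c) / c"
  define y where "y = g V (P T) / c\<^sup>2"
  define w where "w = g V T / c"
  have xyw: "x * c + w = e V" "y * c\<^sup>2 = g V (P T)" "w * c = g V T"
    using assms by (simp_all add: x_def y_def w_def)
  have "g (P T) (P T) = c\<^sup>2" using assms by (simp add: g_P_P power2_eq_square)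
  then have "V - (x *\<^sub>R T + y *\<^sub>R P T + w *\<^sub>R z) = 0"
    using assms xyw
    by (intro null_frame_complete[OF assms(1)])
      (simp_all add: blinfun.bilinear_simps g_P_self e_P e_z)
  then show ?thesis unfolding x_def y_def w_def by simp
qed

text \<open>
  The plane orthogonal to \<open>z\<close> has signature \<open>(1, 1)\<close>. A nonzero null vector spans its own
  orthogonal complement there, and this line contains no unit vector.
\<close>

lemma null_orthogonal_to_unit:
  assumes "g T T = 0" "e T = 0" "g N N = 1" "e N = 0" "g N T = 0"
  shows "T = 0"
proof -
  obtain u w where uw: "P u = u" "P w = - w" "e u = 0" "e w = 0"
    and null: "g u u = 0" "g w w = 0" and E: "g u w \<noteq> 0"
    and dec: "\<And>v. v = e v *\<^sub>R z + (g v w / g u w) *\<^sub>R u + (g v u / g u w) *\<^sub>R w"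
    by (rule eigenbasis, rule that)
  have g: "g v v' = (g v w * g v' u + g v u * g v' w) / g u w" if "e v' = 0" for v v'
  proof -
    have "g v v' = g v (e v' *\<^sub>R z + (g v' w / g u w) *\<^sub>R u + (g v' u / g u w) *\<^sub>R w)"
      using dec[of v'] by (rule arg_cong)
    then show ?thesis using that by (simp add: blinfun.bilinear_simps add_divide_distrib mult.commute)
  qed
  have "g T w * g T u = 0" using g[of T T] assms E by auto
  moreover have "g N w * g N u \<noteq> 0" using g[of N N] assms E by auto
  moreover have "g N w * g T u + g N u * g T w = 0" using g[of T N] assms E by auto
  ultimately have "g T w = 0" "g T u = 0" by auto
  then show ?thesis using dec[of T] assms by simp
qed

end

section \<open>Charts and coordinate fields\<close>

locale smooth_atlas =
  fixes A :: "('m::{t2_space, second_countable_topology}, 'd::finite) chart set"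
  assumes smooth_manifold: "smooth_manifold A"
begin

lemma chart:
  assumes "a \<in> A"
  shows open_cdom: "open (cdom a)"
    and cinv_cmap: "p \<in> cdom a \<Longrightarrow> cinv a (cmap a p) = p"
    and cmap_cinv: "x \<in> cmap a ` cdom a \<Longrightarrow> cmap a (cinv a x) = x"
    and cinv_in: "x \<in> cmap a ` cdom a \<Longrightarrow> cinv a x \<in> cdom a"
  using smooth_manifold assms
  by (auto simp: smooth_manifold_def homeomorphism_def)

lemma chart_at: obtains a where "a \<in> A" "p \<in> cdom a"
proof -
  have "p \<in> (\<Union>a\<in>A. cdom a)" using smooth_manifold by (simp add: smooth_manifold_def)
  then show ?thesis using that by blast
qed

lemma open_chart_image:
  assumes "a \<in> A" "open S"
  shows "open (cmap a ` (cdom a \<inter> S))"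
proof -
  have "open (cmap a ` cdom a)" "continuous_on (cmap a ` cdom a) (cinv a)"
    using smooth_manifold assms by (auto simp: smooth_manifold_def homeomorphism_def)
  then have "open (cinv a -` S \<inter> cmap a ` cdom a)"
    using assms continuous_on_open_vimage by blast
  moreover have "cinv a -` S \<inter> cmap a ` cdom a = cmap a ` (cdom a \<inter> S)"
    using cinv_cmap[OF assms(1)] by auto
  ultimately show ?thesis by simp
qed

lemma C_k_on_transition:
  "a \<in> A \<Longrightarrow> b \<in> A \<Longrightarrow> C_k_on k (cmap a ` (cdom a \<inter> cdom b)) (transition a b)"
  using smooth_manifold by (auto simp: smooth_manifold_def smooth_on_def)

lemma transition_has_derivative:
  assumes "a \<in> A" "b \<in> A" "p \<in> cdom a \<inter> cdom b"
  shows "(transition a b has_derivative jac a b p) (at (cmap a p))"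
proof -
  have "transition a b differentiable (at (cmap a p) within cmap a ` (cdom a \<inter> cdom b))"
    using C_k_on_transition[OF assms(1,2), of "Suc 0"] assms(3) by simp
  then have "transition a b differentiable (at (cmap a p))"
    using at_within_open[OF imageI[OF assms(3)] open_chart_image[OF assms(1) open_cdom[OF assms(2)]]]
    by simp
  then show ?thesis unfolding jac_def by (simp add: frechet_derivative_works)
qed

lemma transition_cmap: "a \<in> A \<Longrightarrow> p \<in> cdom a \<Longrightarrow> transition a b (cmap a p) = cmap b p"
  by (simp add: transition_def cinv_cmap)

lemma jac_self:
  assumes "a \<in> A" "p \<in> cdom a"
  shows "jac a a p v = v"
proof -
  have "(transition a a has_derivative (\<lambda>v. v)) (at (cmap a p))"
    using open_chart_image[OF assms(1) open_UNIV] assms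
    by (intro has_derivative_transform_within_open[OF has_derivative_ident])
      (auto simp: transition_cmap)
  moreover have "(transition a a has_derivative jac a a p) (at (cmap a p))"
    using assms by (intro transition_has_derivative) auto
  ultimately have "(\<lambda>v. v) = jac a a p" by (rule has_derivative_unique)
  from fun_cong[OF this, symmetric] show ?thesis .
qed

lemma jac_cocycle:
  assumes "a \<in> A" "b \<in> A" "c \<in> A" and p: "p \<in> cdom a \<inter> cdom b \<inter> cdom c"
  shows "jac a c p v = jac b c p (jac a b p v)"
proof -
  have "(transition a b has_derivative jac a b p) (at (cmap a p))"
    using assms by (intro transition_has_derivative) auto
  moreover have "(transition b c has_derivative jac b c p) (at (transition a b (cmap a p)))"
    using assms transition_has_derivative[of b c p] by (simp add: transition_cmap)
  ultimately have "((\<lambda>x. transition b c (transition a b x)) has_derivative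
      (\<lambda>v. jac b c p (jac a b p v))) (at (cmap a p))"
    by (rule has_derivative_compose)
  then have "(transition a c has_derivative (\<lambda>v. jac b c p (jac a b p v))) (at (cmap a p))"
    by (rule has_derivative_transform_within_open)
      (use open_chart_image[OF assms(1) open_cdom[OF assms(2)]] p in \<open>auto simp: transition_cmap assms\<close>)
  moreover have "(transition a c has_derivative jac a c p) (at (cmap a p))"
    using assms by (intro transition_has_derivative) auto
  ultimately have "(\<lambda>v. jac b c p (jac a b p v)) = jac a c p" by (rule has_derivative_unique)
  from fun_cong[OF this, symmetric] show ?thesis .
qed

text \<open>
  The field with constant components \<open>v\<close> in the chart \<open>a\<close>. Testing tensorial identities on
  such fields turns them into identities between derivatives of components.
\<close>

definition coord_field :: "('m, 'd) chart \<Rightarrow> real ^ 'd \<Rightarrow> ('m, 'd) vfield" where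
  "coord_field a v = (\<lambda>b p. jac a b p v)"

lemma coord_field_self: "a \<in> A \<Longrightarrow> p \<in> cdom a \<Longrightarrow> coord_field a v a p = v"
  by (simp add: coord_field_def jac_self)

text \<open>
  In another chart \<open>b\<close> the components are \<open>(D\<^sub>v \<theta>) \<circ> \<theta>\<inverse>\<close>, where \<open>\<theta>\<close> is the change of
  coordinates from \<open>a\<close> to \<open>b\<close>; so smoothness is the closure of smooth maps under composition.
\<close>

lemma vector_field_coord_field:
  assumes "a \<in> A"
  shows "vector_field_on A (cdom a) (coord_field a v)"
  unfolding vector_field_on_def smooth_components_def smooth_on_def
proof (intro conjI ballI allI)
  fix b c p assume "b \<in> A" "c \<in> A" "p \<in> cdom b \<inter> cdom c \<inter> cdom a"
  then show "coord_field a v c p = jac b c p (coord_field a v b p)"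
    unfolding coord_field_def using assms by (intro jac_cocycle) auto
next
  fix b k assume b: "b \<in> A"
  define S where "S = cmap b ` (cdom b \<inter> cdom a)"
  define T where "T = cmap a ` (cdom a \<inter> cdom b)"
  have op: "open S" "open T"
    unfolding S_def T_def by (simp_all add: open_chart_image open_cdom assms b)
  have "C_k_on (Suc k) T (transition a b)"
    unfolding T_def by (rule C_k_on_transition[OF assms b])
  then have "C_k_on k T (\<lambda>y. frechet_derivative (transition a b) (at y within T) v)"
    by simp
  then have "C_k_on k T (\<lambda>y. frechet_derivative (transition a b) (at y) v)"
    by (simp add: at_within_open[OF _ op(2)] cong: C_k_on_cong)
  moreover have "transition b a ` S \<subseteq> T"
    unfolding S_def T_def by (auto simp: transition_cmap b)
  moreover have "C_k_on k S (transition b a)"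
    unfolding S_def by (rule C_k_on_transition[OF b assms])
  ultimately have "C_k_on k S (\<lambda>x. frechet_derivative (transition a b) (at (transition b a x)) v)"
    by (intro C_k_on_compose[OF op, where f = "\<lambda>y. frechet_derivative (transition a b) (at y) v"])
  then show "C_k_on k (cmap b ` (cdom b \<inter> cdom a)) (coord_field a v b \<circ> cinv b)"
    unfolding S_def by (simp add: coord_field_def jac_def transition_def o_def)
qed

lemma chart_constant_derivative:
  assumes "a \<in> A" "p \<in> cdom a" "(F has_derivative D) (at (cmap a p))"
    and "\<And>q. q \<in> cdom a \<Longrightarrow> F (cmap a q) = k"
  shows "D v = 0"
proof -
  have "open (cmap a ` cdom a)" using open_chart_image[OF assms(1) open_UNIV] by simp
  then have "((\<lambda>x. k) has_derivative D) (at (cmap a p))"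
    by (rule has_derivative_transform_within_open[OF assms(3)]) (use assms in auto)
  then have "D = (\<lambda>v. 0)" using has_derivative_const has_derivative_unique by blast
  then show ?thesis by simp
qed

lemma vector_field_on_subset:
  assumes "vector_field_on A T X" "open S" "open T" "S \<subseteq> T"
  shows "vector_field_on A S X"
proof -
  have smooth: "smooth_components A T X"
    and law: "\<forall>a\<in>A. \<forall>b\<in>A. \<forall>p \<in> cdom a \<inter> cdom b \<inter> T. X b p = jac a b p (X a p)"
    using assms(1) unfolding vector_field_on_def by blast+
  have "C_k_on k (cmap a ` (cdom a \<inter> S)) (X a \<circ> cinv a)" if "a \<in> A" for a k
  proof (rule C_k_on_open_subset)
    show "C_k_on k (cmap a ` (cdom a \<inter> T)) (X a \<circ> cinv a)"
      using smooth that by (simp add: smooth_components_def smooth_on_def)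
  qed (use assms that open_chart_image in auto)
  then have "smooth_components A S X" by (simp add: smooth_components_def smooth_on_def)
  moreover have "\<forall>a\<in>A. \<forall>b\<in>A. \<forall>p \<in> cdom a \<inter> cdom b \<inter> S. X b p = jac a b p (X a p)"
    using law assms(4) by blast
  ultimately show ?thesis unfolding vector_field_on_def by blast
qed

lemma has_dir_deriv:
  assumes "smooth_components A S F" "open S" "a \<in> A" "p \<in> cdom a" "p \<in> S"
  shows "((\<lambda>x. F a (cinv a x)) has_derivative dir_deriv a (F a) p) (at (cmap a p))"
proof -
  have "C_k_on (Suc 0) (cmap a ` (cdom a \<inter> S)) (F a \<circ> cinv a)"
    using assms unfolding smooth_components_def smooth_on_def by blast
  then have "(F a \<circ> cinv a) differentiable (at (cmap a p) within cmap a ` (cdom a \<inter> S))"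
    using assms by simp
  then have "(F a \<circ> cinv a) differentiable (at (cmap a p))"
    using at_within_open[OF imageI[OF IntI[OF assms(4,5)]] open_chart_image[OF assms(3,2)]] by simp
  then show ?thesis
    unfolding dir_deriv_def frechet_derivative_works by (simp add: o_def)
qed

lemma dir_deriv_eq:
  assumes "a \<in> A" "p \<in> cdom a" "(F has_derivative D) (at (cmap a p))"
    and "\<And>q. q \<in> cdom a \<Longrightarrow> f q = F (cmap a q)"
  shows "dir_deriv a f p v = D v"
proof -
  have "((f \<circ> cinv a) has_derivative D) (at (cmap a p))"
    using open_chart_image[OF assms(1) open_UNIV] assms
    by (intro has_derivative_transform_within_open[OF assms(3)])
      (auto simp: cinv_cmap cinv_in)
  from frechet_derivative_at[OF this] show ?thesis by (simp add: dir_deriv_def)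
qed

end

section \<open>The covariant derivative of the characteristic field\<close>

locale normal_paracontact_3manifold = smooth_atlas A
  for A :: "('m::{t2_space, second_countable_topology}, 3) chart set" +
  fixes \<phi> :: "('m, 3) endofield" and \<xi> :: "('m, 3) vfield" and \<eta> :: "('m, 3) covfield"
    and g :: "('m, 3) bilfield" and G :: "('m, 3) conn"
  assumes metric_structure: "almost_paracontact_metric A 1 \<phi> \<xi> \<eta> g"
    and normality: "normal A \<phi> \<xi> \<eta>"
    and levi_civita: "levi_civita A g G"
begin

lemma tangent_space:
  assumes "a \<in> A" "p \<in> cdom a"
  shows "paracontact_metric_space (\<phi> a p) (\<xi> a p) (\<eta> a p) (g a p)"
proof -
  have st: "almost_paracontact A 1 \<phi> \<xi> \<eta>" "pseudo_riemannian_metric A (1 + 1) 1 g"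
    using metric_structure by (simp_all add: almost_paracontact_metric_def)
  then have "has_signature (g a p) (1 + 1) 1" "\<And>v w. g a p v w = g a p w v"
    using assms unfolding pseudo_riemannian_metric_def by blast+
  moreover have "\<eta> a p (\<xi> a p) = 1"
      "\<And>v. \<phi> a p (\<phi> a p v) = v - \<eta> a p v *\<^sub>R \<xi> a p"
      "dim {v. \<eta> a p v = 0 \<and> \<phi> a p v = v} = 1"
      "dim {v. \<eta> a p v = 0 \<and> \<phi> a p v = - v} = 1"
    using st(1) assms unfolding almost_paracontact_def by blast+
  moreover have "\<And>v w. g a p (\<phi> a p v) (\<phi> a p w) = - g a p v w + \<eta> a p v * \<eta> a p w"
    using metric_structure assms unfolding almost_paracontact_metric_def by blast
  ultimately show ?thesis
    by unfold_locales (blast intro: signature_nondegenerate | assumption)+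
qed

lemma smooth_components_structure:
  "smooth_components A UNIV \<phi>" "smooth_components A UNIV \<xi>" "smooth_components A UNIV g"
  using metric_structure
  unfolding almost_paracontact_metric_def almost_paracontact_def endo_field_def
    vector_field_on_def pseudo_riemannian_metric_def bilinear_field_def by blast+

lemmas phi_has_dir_deriv = has_dir_deriv[OF smooth_components_structure(1) open_UNIV _ _ UNIV_I]
lemmas xi_has_dir_deriv = has_dir_deriv[OF smooth_components_structure(2) open_UNIV _ _ UNIV_I]
lemmas g_has_dir_deriv = has_dir_deriv[OF smooth_components_structure(3) open_UNIV _ _ UNIV_I]

lemma vector_field_xi: "open S \<Longrightarrow> vector_field_on A S \<xi>"
  using metric_structure vector_field_on_subset[of UNIV \<xi> S]
  by (simp add: almost_paracontact_metric_def almost_paracontact_def)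

lemmas torsion_free = levi_civita
  [unfolded levi_civita_def, THEN conjunct2, THEN conjunct1, rule_format, OF conjI, OF _ conjI]

lemmas metric_compatible = levi_civita
  [unfolded levi_civita_def, THEN conjunct2, THEN conjunct2, rule_format, OF conjI, OF _ conjI,
    OF _ _ conjI]

lemma dir_deriv_coord_field:
  "a \<in> A \<Longrightarrow> p \<in> cdom a \<Longrightarrow> dir_deriv a (coord_field a v a) p u = 0"
  by (rule dir_deriv_eq[OF _ _ has_derivative_const]) (auto simp: coord_field_self)

lemma dir_deriv_metric:
  assumes "a \<in> A" "p \<in> cdom a"
  shows "dir_deriv a (g a) p u v w = g a p (G a p u v) w + g a p v (G a p u w)"
proof -
  let ?X = "coord_field a u" and ?Y = "coord_field a v" and ?Z = "coord_field a w"
  have "dir_deriv a (\<lambda>q. g a q (?Y a q) (?Z a q)) p (?X a p) =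
      g a p (nabla G ?X ?Y a p) (?Z a p) + g a p (?Y a p) (nabla G ?X ?Z a p)"
    by (rule metric_compatible[of "cdom a"])
      (simp_all add: vector_field_coord_field open_cdom assms)
  moreover have "((\<lambda>x. g a (cinv a x) v w) has_derivative (\<lambda>u. dir_deriv a (g a) p u v w))
      (at (cmap a p))"
    by (intro bounded_linear.has_derivative[OF blinfun.bounded_linear_left] g_has_dir_deriv assms)
  then have "dir_deriv a (\<lambda>q. g a q (?Y a q) (?Z a q)) p u = dir_deriv a (g a) p u v w"
    by (rule dir_deriv_eq[OF assms]) (simp add: coord_field_self cinv_cmap assms)
  ultimately show ?thesis
    by (simp add: coord_field_self assms nabla_def nabla_at_def dir_deriv_coord_field)
qed

text \<open>Since the connection is torsion free, ordinary derivatives of \<open>\<xi>\<close> can be expressed by \<open>\<nabla>\<xi>\<close>.\<close>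

lemma dir_deriv_xi:
  assumes "a \<in> A" "p \<in> cdom a"
  shows "dir_deriv a (\<xi> a) p v = nabla_at G \<xi> a p v - G a p (\<xi> a p) v"
proof -
  let ?X = "coord_field a v"
  have "nabla G ?X \<xi> a p - nabla G \<xi> ?X a p = lie_bracket ?X \<xi> a p"
    by (rule torsion_free[of "cdom a"])
      (simp_all add: vector_field_coord_field vector_field_xi open_cdom assms)
  then show ?thesis
    by (simp add: coord_field_self assms nabla_def nabla_at_def lie_bracket_def
        dir_deriv_coord_field algebra_simps)
qed

text \<open>
  The product rule in terms of covariant derivatives. The fields are given by their components in
  coordinates, so the lemma covers constant components, \<open>\<xi>\<close> and \<open>\<phi>\<close> applied to a constant.
\<close>

lemma metric_has_derivative:
  assumes "a \<in> A" "p \<in> cdom a"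
    and "(X has_derivative X') (at (cmap a p))" "(Y has_derivative Y') (at (cmap a p))"
  shows "((\<lambda>x. g a (cinv a x) (X x) (Y x)) has_derivative
      (\<lambda>u. g a p (X' u + G a p u (X (cmap a p))) (Y (cmap a p))
         + g a p (X (cmap a p)) (Y' u + G a p u (Y (cmap a p))))) (at (cmap a p))"
  using blinfun.FDERIV[OF blinfun.FDERIV[OF g_has_dir_deriv[OF assms(1,2)] assms(3)] assms(4)]
  by (rule has_derivative_eq_rhs)
    (simp add: fun_eq_iff cinv_cmap assms dir_deriv_metric blinfun.bilinear_simps)

lemma nabla_xi_linear:
  assumes "a \<in> A" "p \<in> cdom a"
  shows "linear (nabla_at G \<xi> a p)"
  unfolding nabla_at_def
  by (intro linear_compose_add bounded_linear.linear has_derivative_bounded_linear[OF xi_has_dir_deriv]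
      bounded_linear_intros assms)

text \<open>
  The derivative of \<open>g(\<xi>, \<xi>) = 1\<close>.
\<close>

lemma nabla_xi_orthogonal:
  assumes "a \<in> A" "p \<in> cdom a"
  shows "\<eta> a p (nabla_at G \<xi> a p v) = 0"
proof -
  interpret paracontact_metric_space "\<phi> a p" "\<xi> a p" "\<eta> a p" "g a p"
    by (rule tangent_space[OF assms])
  have "g a q (\<xi> a q) (\<xi> a q) = 1" if "q \<in> cdom a" for q
  proof -
    interpret q: paracontact_metric_space "\<phi> a q" "\<xi> a q" "\<eta> a q" "g a q"
      by (rule tangent_space[OF assms(1) that])
    show ?thesis by (simp add: q.e_z)
  qed
  with chart_constant_derivative[OF assms
      metric_has_derivative[OF assms xi_has_dir_deriv[OF assms] xi_has_dir_deriv[OF assms]], of 1 v]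
  show ?thesis by (simp add: cinv_cmap assms nabla_at_def)
qed

text \<open>
  This is the normality condition for a coordinate field \<open>v\<close> and \<open>\<xi>\<close>, with Lie brackets
  rewritten through the connection; \<open>K = \<nabla>\<^sub>\<xi> \<phi>\<close>. The brackets with \<open>\<phi>\<xi>\<close> vanish because
  \<open>\<phi>\<xi> = 0\<close>. The terms with Christoffel symbols go into \<open>K\<close> in the Nijenhuis tensor and cancel
  in \<open>2 d\<eta>(v,\<xi>) = - g(v, \<nabla>\<^sub>\<xi> \<xi>)\<close>.
\<close>

lemma normality_equation:
  assumes "a \<in> A" "p \<in> cdom a"
  defines "h \<equiv> nabla_at G \<xi> a p"
  defines "K \<equiv> \<lambda>v. dir_deriv a (\<phi> a) p (\<xi> a p) v + G a p (\<xi> a p) (\<phi> a p v)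
                 - \<phi> a p (G a p (\<xi> a p) v)"
  shows "\<phi> a p (\<phi> a p (h v)) - \<phi> a p (h (\<phi> a p v)) + \<phi> a p (K v)
    + g a p v (h (\<xi> a p)) *\<^sub>R \<xi> a p = 0"
proof -
  interpret paracontact_metric_space "\<phi> a p" "\<xi> a p" "\<eta> a p" "g a p"
    by (rule tangent_space[OF assms(1,2)])
  let ?X = "coord_field a v"
  have xi: "\<phi> a q (\<xi> a q) = 0" "\<eta> a q (\<xi> a q) = 1" "\<eta> a q v = g a q v (\<xi> a q)"
    if "q \<in> cdom a" for q
  proof -
    interpret q: paracontact_metric_space "\<phi> a q" "\<xi> a q" "\<eta> a q" "g a q"
      by (rule tangent_space[OF assms(1) that])
    show "\<phi> a q (\<xi> a q) = 0" "\<eta> a q (\<xi> a q) = 1" "\<eta> a q v = g a q v (\<xi> a q)"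
      by (simp_all add: q.P_z q.e_z)
  qed
  have phi_X: "dir_deriv a (app_endo \<phi> ?X a) p u = dir_deriv a (\<phi> a) p u v" for u
    by (rule dir_deriv_eq[OF assms(1,2)
          bounded_linear.has_derivative[OF blinfun.bounded_linear_left phi_has_dir_deriv[OF assms(1,2)]]])
      (simp add: app_endo_def coord_field_self cinv_cmap assms)
  have phi_0: "dir_deriv a (\<phi> a) p 0 = 0"
    using phi_has_dir_deriv[OF assms(1,2)] by (simp add: has_derivative_def bounded_linear.linear linear_0)
  have phi_xi: "dir_deriv a (app_endo \<phi> \<xi> a) p u = 0" for u
    by (rule dir_deriv_eq[OF assms(1,2) has_derivative_const]) (simp add: app_endo_def xi)
  have eta_xi: "dir_deriv a (\<lambda>q. \<eta> a q (\<xi> a q)) p u = 0" for u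
    by (rule dir_deriv_eq[OF assms(1,2) has_derivative_const]) (simp add: xi)
  have eta_X: "dir_deriv a (\<lambda>q. \<eta> a q (?X a q)) p u =
      g a p (0 + G a p u v) (\<xi> a (cinv a (cmap a p)))
      + g a p v (dir_deriv a (\<xi> a) p u + G a p u (\<xi> a (cinv a (cmap a p))))" for u
    by (rule dir_deriv_eq[OF assms(1,2)
          metric_has_derivative[OF assms(1,2) has_derivative_const xi_has_dir_deriv[OF assms(1,2)]]])
      (simp add: coord_field_self cinv_cmap assms xi)
  have D: "dir_deriv a (\<xi> a) p u = h u - G a p (\<xi> a p) u" for u
    unfolding h_def by (rule dir_deriv_xi[OF assms(1,2)])
  have "nijenhuis \<phi> ?X \<xi> a p - (2 * ext_deriv \<eta> ?X \<xi> a p) *\<^sub>R \<xi> a p = 0"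
    using normality[unfolded normal_def, rule_format, OF conjI, OF _ conjI, of "cdom a" ?X \<xi> a p]
    by (simp add: vector_field_coord_field vector_field_xi open_cdom assms)
  moreover have "nijenhuis \<phi> ?X \<xi> a p =
      \<phi> a p (\<phi> a p (dir_deriv a (\<xi> a) p v))
      - \<phi> a p (dir_deriv a (\<xi> a) p (\<phi> a p v) - dir_deriv a (\<phi> a) p (\<xi> a p) v)"
    unfolding nijenhuis_def lie_bracket_def phi_X phi_xi
    by (simp add: app_endo_def coord_field_self assms dir_deriv_coord_field P_z phi_0)
  moreover have "2 * ext_deriv \<eta> ?X \<xi> a p =
      - (g a p (G a p (\<xi> a p) v) (\<xi> a p) + g a p v (h (\<xi> a p))) - \<eta> a p (dir_deriv a (\<xi> a) p v)"
    unfolding ext_deriv_def eta_xi eta_X lie_bracket_def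
    by (simp add: coord_field_self cinv_cmap assms dir_deriv_coord_field nabla_at_def)
  moreover have "\<eta> a p (h v) = 0"
    unfolding h_def by (rule nabla_xi_orthogonal[OF assms(1,2)])
  ultimately show ?thesis
    unfolding D K_def by (simp add: blinfun.bilinear_simps P_P algebra_simps e_P)
qed

text \<open>
  Applying \<open>\<eta>\<close> to the normality equation kills everything except \<open>g(v, \<nabla>\<^sub>\<xi> \<xi>)\<close>.
\<close>

lemma nabla_xi_xi:
  assumes "a \<in> A" "p \<in> cdom a"
  shows "nabla_at G \<xi> a p (\<xi> a p) = 0"
proof -
  interpret paracontact_metric_space "\<phi> a p" "\<xi> a p" "\<eta> a p" "g a p"
    by (rule tangent_space[OF assms])
  have "g a p v (nabla_at G \<xi> a p (\<xi> a p)) = 0" for v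
    using arg_cong[OF normality_equation[OF assms, of v], of "\<lambda>v. \<eta> a p v"]
    by (simp add: blinfun.bilinear_simps e_P e_z)
  then show ?thesis using sym nondegenerate by metis
qed

text \<open>
  The inner product of the normality equation with \<open>v\<close> is \<open>2 g(\<nabla>\<^sub>v \<xi>, v) = 0\<close> up to the term
  \<open>g(\<phi>Kv, v) = - g(Kv, \<phi>v) = - s g(Kv, v)\<close>. That term vanishes because \<open>K = \<nabla>\<^sub>\<xi> \<phi>\<close> inherits
  the skew symmetry of \<open>\<phi>\<close>. For this, \<open>g(\<phi>v, v) = 0\<close> is differentiated along \<open>\<xi>\<close> with \<open>v\<close>
  extended by constant components.
\<close>

lemma nabla_xi_eigenvector:
  assumes "a \<in> A" "p \<in> cdom a" and s: "s \<in> {1, -1}" "\<eta> a p v = 0" "\<phi> a p v = s *\<^sub>R v"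
  shows "g a p (nabla_at G \<xi> a p v) v = 0"
proof -
  interpret paracontact_metric_space "\<phi> a p" "\<xi> a p" "\<eta> a p" "g a p"
    by (rule tangent_space[OF assms(1,2)])
  let ?h = "nabla_at G \<xi> a p"
  define K where "K = dir_deriv a (\<phi> a) p (\<xi> a p) v + G a p (\<xi> a p) (\<phi> a p v)
                 - \<phi> a p (G a p (\<xi> a p) v)"
  have "g a q (\<phi> a q v) v = 0" if "q \<in> cdom a" for q
  proof -
    interpret q: paracontact_metric_space "\<phi> a q" "\<xi> a q" "\<eta> a q" "g a q"
      by (rule tangent_space[OF assms(1) that])
    show ?thesis by (rule q.g_P_self)
  qed
  \<comment> \<open>the derivative of \<open>g(\<phi>v, v) = 0\<close> in the direction \<open>\<xi>\<close>\<close>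
  with chart_constant_derivative[OF assms(1,2) metric_has_derivative[OF assms(1,2)
        bounded_linear.has_derivative[OF blinfun.bounded_linear_left phi_has_dir_deriv[OF assms(1,2)]]
        has_derivative_const], of v v 0 "\<xi> a p"]
  have "g a p (dir_deriv a (\<phi> a) p (\<xi> a p) v + G a p (\<xi> a p) (\<phi> a p v)) v
      + g a p (\<phi> a p v) (G a p (\<xi> a p) v) = 0"
    by (simp add: cinv_cmap assms)
  then have K: "g a p K v = 0"
    unfolding K_def by (simp add: blinfun.bilinear_simps g_P_skew sym[of v])
  have "g a p (\<phi> a p (\<phi> a p (?h v)) - \<phi> a p (?h (\<phi> a p v)) + \<phi> a p K
    + g a p v (?h (\<xi> a p)) *\<^sub>R \<xi> a p) v = 0"
    unfolding K_def normality_equation[OF assms(1,2)] by simp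
  then show ?thesis
    using K s linear_scale[OF nabla_xi_linear[OF assms(1,2)], of s v]
    by (auto simp: blinfun.bilinear_simps g_P_skew nabla_xi_xi assms(1,2))
qed

text \<open>
  By the preceding lemmas \<open>\<nabla>\<xi>\<close> satisfies the hypotheses of \<open>diagonal_operator\<close>, and the
  associated functions are half the traces that occur there.
\<close>

lemma nabla_xi:
  assumes "associated_functions A \<phi> \<xi> G \<alpha> \<beta>" "a \<in> A" "p \<in> cdom a"
  shows "nabla_at G \<xi> a p v = \<alpha> p *\<^sub>R (v - \<eta> a p v *\<^sub>R \<xi> a p) + \<beta> p *\<^sub>R \<phi> a p v"
proof -
  interpret paracontact_metric_space "\<phi> a p" "\<xi> a p" "\<eta> a p" "g a p"
    by (rule tangent_space[OF assms(2,3)])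
  have "trace (matrix (nabla_at G \<xi> a p)) = 2 * \<alpha> p"
    "trace (matrix (\<lambda>v. \<phi> a p (nabla_at G \<xi> a p v))) = 2 * \<beta> p"
    using assms unfolding associated_functions_def by auto
  moreover have "nabla_at G \<xi> a p v = (trace (matrix (nabla_at G \<xi> a p)) / 2) *\<^sub>R (v - \<eta> a p v *\<^sub>R \<xi> a p)
      + (trace (matrix (\<lambda>v. \<phi> a p (nabla_at G \<xi> a p v))) / 2) *\<^sub>R \<phi> a p v"
    by (intro diagonal_operator nabla_xi_linear nabla_xi_xi nabla_xi_orthogonal
        nabla_xi_eigenvector assms(2,3))
  ultimately show ?thesis by simp
qed

end

section \<open>Fields along a null curve\<close>

locale framed_null_curve = normal_paracontact_3manifold A \<phi> \<xi> \<eta> g G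
  for A :: "('m::{t2_space, second_countable_topology}, 3) chart set"
    and \<phi> :: "('m, 3) endofield" and \<xi> :: "('m, 3) vfield" and \<eta> :: "('m, 3) covfield"
    and g :: "('m, 3) bilfield" and G :: "('m, 3) conn" +
  fixes \<alpha> \<beta> :: "'m \<Rightarrow> real" and I :: "real set" and \<gamma> :: "real \<Rightarrow> 'm" and c :: real
    and \<tau> :: "real \<Rightarrow> real" and N W :: "('m, 3) cfield"
  assumes assoc: "associated_functions A \<phi> \<xi> G \<alpha> \<beta>"
    and smooth: "smooth_curve A I \<gamma>"
    and slant: "slant_curve A \<eta> I \<gamma> c"
    and null: "null_curve A g I \<gamma>"
    and unit: "unit_acceleration A g G I \<gamma>"
    and frame: "cartan_frame A g G I \<gamma> \<tau> N W"
begin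

abbreviation "T \<equiv> velocity I \<gamma>"

abbreviation "D \<equiv> cov_deriv I \<gamma> G"

lemma curve_domD: "t \<in> curve_dom I \<gamma> a \<Longrightarrow> t \<in> I" "t \<in> curve_dom I \<gamma> a \<Longrightarrow> \<gamma> t \<in> cdom a"
  by (simp_all add: curve_dom_def)

lemma nontrivial_interval: "t \<in> I \<Longrightarrow> at t within I \<noteq> bot"
proof -
  assume t: "t \<in> I"
  have I: "is_interval I" "interior I \<noteq> {}" using smooth by (simp_all add: smooth_curve_def)
  then have "I \<noteq> {x}" for x by (metis interior_singleton)
  then have "t islimpt I" using connected_imp_perfect t I is_interval_connected by blast
  then show ?thesis by (simp add: trivial_limit_within)
qed

text \<open>
  Smoothness is stated within the part of the interval mapped into a chart, whereas velocities and
  covariant derivatives are taken within the whole interval. Both filters agree because that part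
  is relatively open.
\<close>

lemma at_within_curve_dom:
  assumes "a \<in> A" "t \<in> curve_dom I \<gamma> a"
  shows "at t within curve_dom I \<gamma> a = at t within I"
proof -
  have "continuous_on I \<gamma>" using smooth by (simp add: smooth_curve_def)
  then obtain U where U: "open U" "U \<inter> I = \<gamma> -` cdom a \<inter> I"
    using open_cdom[OF assms(1)] by (auto simp: continuous_on_open_invariant)
  then have "curve_dom I \<gamma> a = U \<inter> I" by (auto simp: curve_dom_def)
  then show ?thesis
    using U assms(2) by (intro at_within_nhd[of t U]) auto
qed

lemma eventually_in_curve_dom:
  assumes "a \<in> A" "t \<in> curve_dom I \<gamma> a"
  shows "eventually (\<lambda>s. s \<in> curve_dom I \<gamma> a) (at t within I)"
  unfolding at_within_curve_dom[OF assms, symmetric] by (simp add: eventually_at_filter)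

lemma has_vector_derivative_curve_dom_cong:
  assumes "a \<in> A" "t \<in> curve_dom I \<gamma> a" "(f has_vector_derivative f') (at t within I)"
    and "\<And>s. s \<in> curve_dom I \<gamma> a \<Longrightarrow> h s = f s"
  shows "(h has_vector_derivative f') (at t within I)"
proof -
  have "(f has_vector_derivative f') (at t within curve_dom I \<gamma> a)"
    using assms(3) unfolding at_within_curve_dom[OF assms(1,2)] .
  with assms(2,4) have "(h has_vector_derivative f') (at t within curve_dom I \<gamma> a)"
    by (rule has_vector_derivative_transform)
  then show ?thesis unfolding at_within_curve_dom[OF assms(1,2)] .
qed

lemma constant_along:
  assumes "a \<in> A" "t \<in> curve_dom I \<gamma> a" "(f has_vector_derivative f') (at t within I)"
    and "\<And>s. s \<in> curve_dom I \<gamma> a \<Longrightarrow> f s = k"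
  shows "f' = 0"
proof -
  have "(f has_vector_derivative 0) (at t within I)"
    by (rule has_vector_derivative_curve_dom_cong[OF assms(1,2) has_vector_derivative_const[of k]])
      (rule assms(4))
  then show ?thesis
    using assms vector_derivative_unique_within nontrivial_interval curve_domD(1) by blast
qed

lemma smooth_along_differentiable:
  assumes "a \<in> A" "t \<in> curve_dom I \<gamma> a" "smooth_on (curve_dom I \<gamma> a) f"
  shows "(f has_vector_derivative vector_derivative f (at t within I)) (at t within I)"
proof -
  have "C_k_on (Suc 0) (curve_dom I \<gamma> a) f"
    using assms(3) unfolding smooth_on_def by blast
  then have "f differentiable (at t within curve_dom I \<gamma> a)"
    using assms(2) by simp
  then show ?thesis
    by (simp add: at_within_curve_dom[OF assms(1,2)] vector_derivative_works)
qed

lemma curve_smooth: "a \<in> A \<Longrightarrow> smooth_on (curve_dom I \<gamma> a) (cmap a \<circ> \<gamma>)"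
  using smooth by (simp add: smooth_curve_def)

lemma curve_has_velocity:
  assumes "a \<in> A" "t \<in> curve_dom I \<gamma> a"
  shows "((cmap a \<circ> \<gamma>) has_vector_derivative T a t) (at t within I)"
  unfolding velocity_def by (intro smooth_along_differentiable[OF assms] curve_smooth assms)

text \<open>
  The velocity is the derivative of the coordinate expression in direction \<open>1\<close>, which is again
  differentiable as the curve is at least twice differentiable.
\<close>

lemma velocity_differentiable:
  assumes "a \<in> A" "t \<in> curve_dom I \<gamma> a"
  shows "(T a has_vector_derivative vector_derivative (T a) (at t within I)) (at t within I)"
proof -
  let ?J = "curve_dom I \<gamma> a"
  let ?T = "\<lambda>s. frechet_derivative (cmap a \<circ> \<gamma>) (at s within ?J) 1"
  have C: "C_k_on (Suc (Suc 0)) ?J (cmap a \<circ> \<gamma>)"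
    using curve_smooth[OF assms(1)] unfolding smooth_on_def by blast
  have eq: "T a s = ?T s" if "s \<in> ?J" for s
  proof -
    have "((cmap a \<circ> \<gamma>) has_derivative frechet_derivative (cmap a \<circ> \<gamma>) (at s within ?J)) (at s within ?J)"
      using C that by (simp add: frechet_derivative_works)
    then have "((cmap a \<circ> \<gamma>) has_vector_derivative ?T s) (at s within I)"
      unfolding at_within_curve_dom[OF assms(1) that] has_derivative_within
      by (simp add: has_vector_derivative_def has_derivative_within bounded_linear.linear
          linear_scale[of _ _ "1::real", symmetric, simplified])
    then show ?thesis
      using curve_has_velocity[OF assms(1) that] vector_derivative_unique_within
        nontrivial_interval curve_domD(1)[OF that] by blast
  qed
  have "?T differentiable (at t within ?J)"
    using C assms(2) by simp
  then have "(?T has_vector_derivative vector_derivative ?T (at t within I)) (at t within I)"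
    by (simp add: at_within_curve_dom[OF assms] vector_derivative_works)
  then have "(T a has_vector_derivative vector_derivative ?T (at t within I)) (at t within I)"
    using eq by (rule has_vector_derivative_curve_dom_cong[OF assms])
  then show ?thesis by (intro vector_derivative_works[THEN iffD1] differentiableI_vector)
qed

lemma component_along:
  assumes "a \<in> A" "t \<in> curve_dom I \<gamma> a"
    and F: "((\<lambda>x. F (cinv a x)) has_derivative F') (at (cmap a (\<gamma> t)))"
  shows "((\<lambda>s. F (\<gamma> s)) has_vector_derivative F' (T a t)) (at t within I)"
proof -
  have "((cmap a \<circ> \<gamma>) has_derivative (\<lambda>r. r *\<^sub>R T a t)) (at t within I)"
    using curve_has_velocity[OF assms(1,2)] unfolding has_vector_derivative_def .
  moreover have "((\<lambda>x. F (cinv a x)) has_derivative F') (at ((cmap a \<circ> \<gamma>) t))"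
    using F by simp
  ultimately have "((\<lambda>s. F (cinv a ((cmap a \<circ> \<gamma>) s))) has_derivative (\<lambda>r. F' (r *\<^sub>R T a t)))
      (at t within I)"
    by (rule has_derivative_compose)
  moreover have "F' (r *\<^sub>R T a t) = r *\<^sub>R F' (T a t)" for r
    by (rule linear_scale[OF has_derivative_linear[OF F]])
  ultimately have "((\<lambda>s. F (cinv a ((cmap a \<circ> \<gamma>) s))) has_vector_derivative F' (T a t)) (at t within I)"
    by (simp add: has_vector_derivative_def)
  then show ?thesis
    by (rule has_vector_derivative_curve_dom_cong[OF assms(1,2)])
      (simp add: cinv_cmap assms curve_domD)
qed

lemma metric_along:
  assumes "a \<in> A" "t \<in> curve_dom I \<gamma> a"
    and V: "(V a has_vector_derivative vector_derivative (V a) (at t within I)) (at t within I)"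
    and U: "(U a has_vector_derivative vector_derivative (U a) (at t within I)) (at t within I)"
  shows "((\<lambda>s. g a (\<gamma> s) (V a s) (U a s)) has_vector_derivative
      g a (\<gamma> t) (D V a t) (U a t) + g a (\<gamma> t) (V a t) (D U a t)) (at t within I)"
proof -
  have p: "\<gamma> t \<in> cdom a" using assms(2) by (rule curve_domD)
  note g = component_along[OF assms(1,2) g_has_dir_deriv[OF assms(1) p]]
  show ?thesis
    using blinfun.has_vector_derivative[OF blinfun.has_vector_derivative[OF g V] U]
    by (rule has_vector_derivative_eq_rhs)
      (simp add: cov_deriv_def dir_deriv_metric[OF assms(1) p] blinfun.bilinear_simps)
qed

lemma xi_along:
  assumes "a \<in> A" "t \<in> curve_dom I \<gamma> a"
  defines "X \<equiv> \<lambda>a s. \<xi> a (\<gamma> s)"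
  shows "(X a has_vector_derivative vector_derivative (X a) (at t within I)) (at t within I)"
    and "D X a t = nabla_at G \<xi> a (\<gamma> t) (T a t)"
proof -
  have p: "\<gamma> t \<in> cdom a" using assms(2) by (rule curve_domD)
  have *: "(X a has_vector_derivative dir_deriv a (\<xi> a) (\<gamma> t) (T a t)) (at t within I)"
    unfolding X_def by (rule component_along[OF assms(1,2) xi_has_dir_deriv[OF assms(1) p]])
  then have "vector_derivative (X a) (at t within I) = dir_deriv a (\<xi> a) (\<gamma> t) (T a t)"
    using vector_derivative_within nontrivial_interval curve_domD(1)[OF assms(2)] by blast
  with * show "(X a has_vector_derivative vector_derivative (X a) (at t within I)) (at t within I)"
    and "D X a t = nabla_at G \<xi> a (\<gamma> t) (T a t)"
    unfolding cov_deriv_def nabla_at_def by (simp_all only: X_def)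
qed

section \<open>Components of the acceleration and of its derivative\<close>

context
  fixes a t
  assumes a: "a \<in> A" and t: "t \<in> curve_dom I \<gamma> a"
begin

lemma tangent_space_along:
  "paracontact_metric_space (\<phi> a (\<gamma> t)) (\<xi> a (\<gamma> t)) (\<eta> a (\<gamma> t)) (g a (\<gamma> t))"
  by (rule tangent_space[OF a curve_domD(2)[OF t]])

lemma N_eq: "N a t = D T a t"
  using frame a t unfolding cartan_frame_def by blast

lemma tau_eq: "\<tau> t = g a (\<gamma> t) (D N a t) (D N a t) / 2"
  using frame a t unfolding cartan_frame_def by blast

lemma W_eq: "W a t = - D N a t - \<tau> t *\<^sub>R T a t"
  using frame a t unfolding cartan_frame_def by blast

lemma N_differentiable:
  "(N a has_vector_derivative vector_derivative (N a) (at t within I)) (at t within I)"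
  using frame a unfolding cartan_frame_def vector_field_along_def
  by (intro smooth_along_differentiable[OF a t]) blast

lemma g_T_T: "g a (\<gamma> t) (T a t) (T a t) = 0"
  using null a t unfolding null_curve_def by blast

lemma eta_T: "\<eta> a (\<gamma> t) (T a t) = c"
  using slant a t unfolding slant_curve_def by blast

lemma g_N_N: "g a (\<gamma> t) (N a t) (N a t) = 1"
  using unit a t unfolding unit_acceleration_def N_eq by blast

lemma nabla_xi_T:
  "nabla_at G \<xi> a (\<gamma> t) (T a t) =
    \<alpha> (\<gamma> t) *\<^sub>R (T a t - c *\<^sub>R \<xi> a (\<gamma> t)) + \<beta> (\<gamma> t) *\<^sub>R \<phi> a (\<gamma> t) (T a t)"
  using nabla_xi[OF assoc a curve_domD(2)[OF t]] by (simp add: eta_T)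

end

text \<open>
  The derivative of \<open>g(T, T) = 0\<close>.
\<close>

lemma g_N_T:
  assumes a: "a \<in> A" and t: "t \<in> curve_dom I \<gamma> a"
  shows "g a (\<gamma> t) (N a t) (T a t) = 0"
proof -
  interpret paracontact_metric_space "\<phi> a (\<gamma> t)" "\<xi> a (\<gamma> t)" "\<eta> a (\<gamma> t)" "g a (\<gamma> t)"
    by (rule tangent_space_along[OF a t])
  have "g a (\<gamma> t) (D T a t) (T a t) + g a (\<gamma> t) (T a t) (D T a t) = 0"
    by (rule constant_along[OF a t metric_along[where V = T and U = T, OF a t velocity_differentiable[OF a t] velocity_differentiable[OF a t]]])
      (rule g_T_T[OF a])
  then show ?thesis by (simp add: N_eq[OF a t] sym[of "T a t"])
qed

text \<open>Differentiating \<open>g(T, \<xi>) = c\<close> shows how \<open>\<alpha>\<close> enters the acceleration.\<close>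

lemma eta_N:
  assumes a: "a \<in> A" and t: "t \<in> curve_dom I \<gamma> a"
  shows "\<eta> a (\<gamma> t) (N a t) = \<alpha> (\<gamma> t) * c\<^sup>2"
proof -
  interpret paracontact_metric_space "\<phi> a (\<gamma> t)" "\<xi> a (\<gamma> t)" "\<eta> a (\<gamma> t)" "g a (\<gamma> t)"
    by (rule tangent_space_along[OF a t])
  have "g a (\<gamma> s) (T a s) (\<xi> a (\<gamma> s)) = c" if "s \<in> curve_dom I \<gamma> a" for s
  proof -
    interpret s: paracontact_metric_space "\<phi> a (\<gamma> s)" "\<xi> a (\<gamma> s)" "\<eta> a (\<gamma> s)" "g a (\<gamma> s)"
      by (rule tangent_space_along[OF a that])
    show ?thesis by (simp add: eta_T[OF a that])
  qed
  from constant_along[OF a t metric_along[where V = T and U = "\<lambda>a s. \<xi> a (\<gamma> s)",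
      OF a t velocity_differentiable[OF a t] xi_along(1)[OF a t]] this]
  show ?thesis
    by (simp add: N_eq[OF a t] xi_along(2)[OF a t] nabla_xi_T[OF a t] blinfun.bilinear_simps
        g_T_T[OF a t] eta_T[OF a t] g_P_self power2_eq_square)
qed

text \<open>
  If \<open>c = 0\<close>, then \<open>T\<close> and the unit vector \<open>N\<close> are orthogonal to \<open>\<xi>\<close> and to each other, so
  the null vector \<open>T\<close> vanishes. This holds on a whole parameter neighbourhood, so the acceleration
  vanishes too, contrary to its being a unit vector.
\<close>

lemma c_nonzero: "c \<noteq> 0"
proof
  assume "c = 0"
  obtain t where "t \<in> I" using smooth unfolding smooth_curve_def by fastforce
  moreover obtain a where a: "a \<in> A" "\<gamma> t \<in> cdom a" using chart_at by blast
  ultimately have t: "t \<in> curve_dom I \<gamma> a" by (simp add: curve_dom_def)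
  have T: "T a s = 0" if "s \<in> curve_dom I \<gamma> a" for s
  proof -
    interpret paracontact_metric_space "\<phi> a (\<gamma> s)" "\<xi> a (\<gamma> s)" "\<eta> a (\<gamma> s)" "g a (\<gamma> s)"
      by (rule tangent_space_along[OF a(1) that])
    note s = a(1) that
    show ?thesis
      using null_orthogonal_to_unit[OF g_T_T[OF s] _ g_N_N[OF s] _ g_N_T[OF s]]
        eta_T[OF s] eta_N[OF s] \<open>c = 0\<close> by simp
  qed
  then have "vector_derivative (T a) (at t within I) = 0"
    by (rule constant_along[OF a(1) t velocity_differentiable[OF a(1) t]])
  then have "N a t = 0"
    by (simp add: N_eq[OF a(1) t] cov_deriv_def T[OF t] blinfun.bilinear_simps)
  then show False using g_N_N[OF a(1) t] by (simp add: blinfun.bilinear_simps)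
qed

text \<open>
  The sign \<open>\<plusminus>\<close> of the theorem. As \<open>g(\<phi>T, \<phi>T) = c\<^sup>2\<close>, the division by \<open>c\<close> makes its square equal
  to \<open>1\<close>.
\<close>

definition frame_sign :: "('m, 3) chart \<Rightarrow> real \<Rightarrow> real" where
  "frame_sign a t = g a (\<gamma> t) (N a t) (\<phi> a (\<gamma> t) (T a t)) / c"

lemma N_expansion:
  assumes a: "a \<in> A" and t: "t \<in> curve_dom I \<gamma> a"
  shows "N a t = (\<alpha> (\<gamma> t) * c) *\<^sub>R T a t + (frame_sign a t / c) *\<^sub>R \<phi> a (\<gamma> t) (T a t)"
proof -
  interpret paracontact_metric_space "\<phi> a (\<gamma> t)" "\<xi> a (\<gamma> t)" "\<eta> a (\<gamma> t)" "g a (\<gamma> t)"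
    by (rule tangent_space_along[OF a t])
  show ?thesis
    using null_frame_expansion[OF g_T_T[OF a t] eta_T[OF a t] c_nonzero, of "N a t"] c_nonzero
    by (simp add: eta_N[OF a t] g_N_T[OF a t] frame_sign_def power2_eq_square)
qed

lemma g_N:
  assumes a: "a \<in> A" and t: "t \<in> curve_dom I \<gamma> a"
  shows "g a (\<gamma> t) V (N a t) = \<alpha> (\<gamma> t) * c * g a (\<gamma> t) V (T a t)
    + frame_sign a t / c * g a (\<gamma> t) V (\<phi> a (\<gamma> t) (T a t))"
  by (subst N_expansion[OF a t]) (simp add: blinfun.bilinear_simps)

lemma frame_sign_square:
  assumes a: "a \<in> A" and t: "t \<in> curve_dom I \<gamma> a"
  shows "frame_sign a t * frame_sign a t = 1"
  using g_N[OF a t, of "N a t"] c_nonzero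
  by (auto simp: g_N_N[OF a t] g_N_T[OF a t] frame_sign_def)

lemma velocity_change_of_chart:
  assumes "a \<in> A" "b \<in> A" "t \<in> curve_dom I \<gamma> a" "t \<in> curve_dom I \<gamma> b"
  shows "T b t = jac a b (\<gamma> t) (T a t)"
proof -
  have "((\<lambda>x. cmap b (cinv a x)) has_derivative jac a b (\<gamma> t)) (at (cmap a (\<gamma> t)))"
    using transition_has_derivative[of a b "\<gamma> t"] assms
    by (simp add: transition_def o_def curve_domD)
  from component_along[OF assms(1,3) this]
  have "((cmap b \<circ> \<gamma>) has_vector_derivative jac a b (\<gamma> t) (T a t)) (at t within I)"
    by (simp add: o_def)
  then show ?thesis
    using curve_has_velocity[OF assms(2,4)] vector_derivative_unique_within
      nontrivial_interval curve_domD(1)[OF assms(3)] by blast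
qed

lemma frame_sign_chart_independent:
  assumes "a \<in> A" "b \<in> A" "t \<in> curve_dom I \<gamma> a" "t \<in> curve_dom I \<gamma> b"
  shows "frame_sign b t = frame_sign a t"
proof -
  have p: "\<gamma> t \<in> cdom a \<inter> cdom b" using assms by (simp add: curve_dom_def)
  have "N b t = jac a b (\<gamma> t) (N a t)"
    using frame assms unfolding cartan_frame_def vector_field_along_def by blast
  moreover have "\<phi> b (\<gamma> t) (jac a b (\<gamma> t) v) = jac a b (\<gamma> t) (\<phi> a (\<gamma> t) v)" for v
    using metric_structure p assms
    unfolding almost_paracontact_metric_def almost_paracontact_def endo_field_def by blast
  moreover have "g b (\<gamma> t) (jac a b (\<gamma> t) v) (jac a b (\<gamma> t) w) = g a (\<gamma> t) v w" for v w
    using metric_structure p assms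
    unfolding almost_paracontact_metric_def pseudo_riemannian_metric_def bilinear_field_def by blast
  ultimately show ?thesis
    by (simp add: frame_sign_def velocity_change_of_chart[OF assms])
qed

lemma frame_sign_locally_constant:
  assumes a: "a \<in> A" and t: "t \<in> curve_dom I \<gamma> a"
  shows "eventually (\<lambda>s. frame_sign a s = frame_sign a t) (at t within I)"
proof -
  have p: "\<gamma> t \<in> cdom a" using t by (rule curve_domD)
  have tendsto: "(f \<longlongrightarrow> f t) (at t within I)" if "(f has_vector_derivative f') (at t within I)"
    for f :: "real \<Rightarrow> 'z::real_normed_vector" and f'
    using has_vector_derivative_continuous[OF that] by (simp add: continuous_within)
  have "(frame_sign a \<longlongrightarrow> frame_sign a t) (at t within I)"
    unfolding frame_sign_def
    by (intro tendsto_divide[OF _ tendsto_const c_nonzero] blinfun.tendsto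
        tendsto[OF component_along[OF a t g_has_dir_deriv[OF a p]]]
        tendsto[OF component_along[OF a t phi_has_dir_deriv[OF a p]]]
        tendsto[OF N_differentiable[OF a t]] tendsto[OF velocity_differentiable[OF a t]])
  then have "eventually (\<lambda>s. dist (frame_sign a s) (frame_sign a t) < 1) (at t within I)"
    by (rule tendstoD) simp
  with eventually_in_curve_dom[OF a t] show ?thesis
  proof eventually_elim
    case (elim s)
    then have "frame_sign a s \<in> {1, -1}" "frame_sign a t \<in> {1, -1}"
      using frame_sign_square[OF a] t by (auto simp: square_eq_1_iff)
    then show ?case using elim by (auto simp: dist_real_def)
  qed
qed

text \<open>
  The sign is continuous with values in \<open>{1, -1}\<close> and does not depend on the chart, so it is
  constant on the connected parameter interval.
\<close>

lemma frame_sign_constant: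
  obtains \<epsilon> where "\<epsilon> \<in> {1, -1}"
    and "\<And>a t. a \<in> A \<Longrightarrow> t \<in> curve_dom I \<gamma> a \<Longrightarrow> frame_sign a t = \<epsilon>"
proof -
  define chart where "chart t = (SOME a. a \<in> A \<and> \<gamma> t \<in> cdom a)" for t
  have chart: "chart t \<in> A" "t \<in> I \<Longrightarrow> t \<in> curve_dom I \<gamma> (chart t)" for t
    using someI_ex[of "\<lambda>a. a \<in> A \<and> \<gamma> t \<in> cdom a"] chart_at[of "\<gamma> t"]
    unfolding chart_def curve_dom_def by blast+
  define f where "f t = frame_sign (chart t) t" for t
  have f: "f t = frame_sign a t" if "a \<in> A" "t \<in> curve_dom I \<gamma> a" for a t
    unfolding f_def
    using frame_sign_chart_independent[OF that(1) chart(1) that(2) chart(2)] curve_domD that by blast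
  obtain t0 where t0: "t0 \<in> I" using smooth unfolding smooth_curve_def by fastforce
  have "eventually (\<lambda>s. f t = f s) (at t within I)" if "t \<in> I" for t
    using frame_sign_locally_constant[OF chart(1) chart(2)[OF that]]
      eventually_in_curve_dom[OF chart(1) chart(2)[OF that]]
    by eventually_elim (use f[OF chart(1)[of t]] chart(2)[OF that] in auto)
  moreover have "connected I" using smooth is_interval_connected by (auto simp: smooth_curve_def)
  ultimately have "f t = f t0" if "t \<in> I" for t
    using connected_local_const[of I t t0 f] t0 that by blast
  moreover have "f t0 \<in> {1, -1}"
    using frame_sign_square[OF chart(1) chart(2)[OF t0]] by (auto simp: f_def square_eq_1_iff)
  ultimately show ?thesis
    using that[of "f t0"] f curve_domD(1) by metis
qed

text \<open>
  The derivative of \<open>g(N, N) = 1\<close>.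
\<close>

lemma g_DN_N:
  assumes a: "a \<in> A" and t: "t \<in> curve_dom I \<gamma> a"
  shows "g a (\<gamma> t) (D N a t) (N a t) = 0"
proof -
  interpret paracontact_metric_space "\<phi> a (\<gamma> t)" "\<xi> a (\<gamma> t)" "\<eta> a (\<gamma> t)" "g a (\<gamma> t)"
    by (rule tangent_space_along[OF a t])
  have "g a (\<gamma> t) (D N a t) (N a t) + g a (\<gamma> t) (N a t) (D N a t) = 0"
    by (rule constant_along[OF a t metric_along[where V = N and U = N, OF a t N_differentiable[OF a t] N_differentiable[OF a t]]])
      (rule g_N_N[OF a])
  then show ?thesis by (simp add: sym[of "N a t"])
qed

text \<open>
  The derivative of \<open>g(N, T) = 0\<close>.
\<close>

lemma g_DN_T:
  assumes a: "a \<in> A" and t: "t \<in> curve_dom I \<gamma> a"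
  shows "g a (\<gamma> t) (D N a t) (T a t) = - 1"
proof -
  have "g a (\<gamma> t) (D N a t) (T a t) + g a (\<gamma> t) (N a t) (D T a t) = 0"
    by (rule constant_along[OF a t metric_along[where V = N and U = T, OF a t N_differentiable[OF a t] velocity_differentiable[OF a t]]])
      (rule g_N_T[OF a])
  then show ?thesis by (simp add: N_eq[OF a t, symmetric] g_N_N[OF a t])
qed

text \<open>Differentiating \<open>g(N, \<xi>) = \<alpha> c\<^sup>2\<close>; in particular \<open>\<alpha>\<close> is differentiable along the curve.\<close>

lemma eta_DN:
  assumes a: "a \<in> A" and t: "t \<in> curve_dom I \<gamma> a"
  shows "\<eta> a (\<gamma> t) (D N a t) = vector_derivative (\<lambda>s. \<alpha> (\<gamma> s)) (at t within I) * c\<^sup>2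
    + (\<alpha> (\<gamma> t))\<^sup>2 * c ^ 3 - frame_sign a t * \<beta> (\<gamma> t) * c"
proof -
  interpret paracontact_metric_space "\<phi> a (\<gamma> t)" "\<xi> a (\<gamma> t)" "\<eta> a (\<gamma> t)" "g a (\<gamma> t)"
    by (rule tangent_space_along[OF a t])
  let ?d = "g a (\<gamma> t) (D N a t) (\<xi> a (\<gamma> t)) + g a (\<gamma> t) (N a t) (nabla_at G \<xi> a (\<gamma> t) (T a t))"
  have "((\<lambda>s. g a (\<gamma> s) (N a s) (\<xi> a (\<gamma> s))) has_vector_derivative ?d) (at t within I)"
    using metric_along[where V = N and U = "\<lambda>a s. \<xi> a (\<gamma> s)",
      OF a t N_differentiable[OF a t] xi_along(1)[OF a t]]
    unfolding xi_along(2)[OF a t] .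
  then have "((\<lambda>s. g a (\<gamma> s) (N a s) (\<xi> a (\<gamma> s)) / c\<^sup>2) has_vector_derivative ?d / c\<^sup>2) (at t within I)"
    by (rule has_vector_derivative_divide)
  then have "((\<lambda>s. \<alpha> (\<gamma> s)) has_vector_derivative ?d / c\<^sup>2) (at t within I)"
  proof (rule has_vector_derivative_curve_dom_cong[OF a t])
    fix s assume s: "s \<in> curve_dom I \<gamma> a"
    interpret s: paracontact_metric_space "\<phi> a (\<gamma> s)" "\<xi> a (\<gamma> s)" "\<eta> a (\<gamma> s)" "g a (\<gamma> s)"
      by (rule tangent_space_along[OF a s])
    show "\<alpha> (\<gamma> s) = g a (\<gamma> s) (N a s) (\<xi> a (\<gamma> s)) / c\<^sup>2"
      using c_nonzero by (simp add: eta_N[OF a s])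
  qed
  then have "vector_derivative (\<lambda>s. \<alpha> (\<gamma> s)) (at t within I) = ?d / c\<^sup>2"
    using vector_derivative_within nontrivial_interval curve_domD(1)[OF t] by blast
  then have "vector_derivative (\<lambda>s. \<alpha> (\<gamma> s)) (at t within I) * c\<^sup>2 = ?d"
    using c_nonzero by simp
  moreover have "g a (\<gamma> t) (N a t) (\<phi> a (\<gamma> t) (T a t)) = frame_sign a t * c"
    using c_nonzero by (simp add: frame_sign_def)
  ultimately show ?thesis
    by (simp add: nabla_xi_T[OF a t] blinfun.bilinear_simps g_N_T[OF a t] eta_N[OF a t]
        power2_eq_square power3_eq_cube algebra_simps)
qed

text \<open>
  The expansion of \<open>N\<close> turns \<open>g(\<nabla>\<^sub>T N, N) = 0\<close> and \<open>g(\<nabla>\<^sub>T N, T) = -1\<close> into an equation for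
  \<open>g(\<nabla>\<^sub>T N, \<phi>T)\<close>.
\<close>

lemma g_DN_phi_T:
  assumes a: "a \<in> A" and t: "t \<in> curve_dom I \<gamma> a"
  shows "g a (\<gamma> t) (D N a t) (\<phi> a (\<gamma> t) (T a t)) = frame_sign a t * \<alpha> (\<gamma> t) * c\<^sup>2"
proof -
  have "frame_sign a t * g a (\<gamma> t) (D N a t) (\<phi> a (\<gamma> t) (T a t)) = \<alpha> (\<gamma> t) * c\<^sup>2"
    using g_N[OF a t, of "D N a t"] c_nonzero
    by (simp add: g_DN_N[OF a t] g_DN_T[OF a t] field_simps power2_eq_square)
  then have "frame_sign a t * (frame_sign a t * g a (\<gamma> t) (D N a t) (\<phi> a (\<gamma> t) (T a t))) =
      frame_sign a t * (\<alpha> (\<gamma> t) * c\<^sup>2)"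
    by simp
  then show ?thesis
    using frame_sign_square[OF a t] by (simp flip: mult.assoc)
qed

lemma DN_expansion:
  assumes a: "a \<in> A" and t: "t \<in> curve_dom I \<gamma> a"
  shows "D N a t = ((\<eta> a (\<gamma> t) (D N a t) + 1 / c) / c) *\<^sub>R T a t
    + (frame_sign a t * \<alpha> (\<gamma> t)) *\<^sub>R \<phi> a (\<gamma> t) (T a t) - (1 / c) *\<^sub>R \<xi> a (\<gamma> t)"
proof -
  interpret paracontact_metric_space "\<phi> a (\<gamma> t)" "\<xi> a (\<gamma> t)" "\<eta> a (\<gamma> t)" "g a (\<gamma> t)"
    by (rule tangent_space_along[OF a t])
  show ?thesis
    using null_frame_expansion[OF g_T_T[OF a t] eta_T[OF a t] c_nonzero, of "D N a t"] c_nonzero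
    by (simp add: g_DN_T[OF a t] g_DN_phi_T[OF a t])
qed

lemma tau_eta_DN:
  assumes a: "a \<in> A" and t: "t \<in> curve_dom I \<gamma> a"
  shows "\<tau> t = ((\<alpha> (\<gamma> t))\<^sup>2 * c\<^sup>2 - 1 / c\<^sup>2) / 2 - \<eta> a (\<gamma> t) (D N a t) / c"
proof -
  interpret paracontact_metric_space "\<phi> a (\<gamma> t)" "\<xi> a (\<gamma> t)" "\<eta> a (\<gamma> t)" "g a (\<gamma> t)"
    by (rule tangent_space_along[OF a t])
  define V where "V = D N a t"
  define k where "k = (\<eta> a (\<gamma> t) V + 1 / c) / c"
  have "g a (\<gamma> t) V V = g a (\<gamma> t) V (k *\<^sub>R T a t
    + (frame_sign a t * \<alpha> (\<gamma> t)) *\<^sub>R \<phi> a (\<gamma> t) (T a t) - (1 / c) *\<^sub>R \<xi> a (\<gamma> t))"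
    using DN_expansion[OF a t] unfolding k_def V_def by (rule arg_cong)
  also have "\<dots> = - k + (frame_sign a t * frame_sign a t) * (\<alpha> (\<gamma> t))\<^sup>2 * c\<^sup>2
      - \<eta> a (\<gamma> t) V / c"
    by (simp add: blinfun.add_right blinfun.diff_right blinfun.scaleR_right
        g_DN_T[OF a t, folded V_def] g_DN_phi_T[OF a t, folded V_def] power2_eq_square)
  finally show ?thesis
    using c_nonzero
    unfolding tau_eq[OF a t] frame_sign_square[OF a t] V_def[symmetric] k_def
    by (simp add: field_simps power2_eq_square)
qed

lemma tau_formula:
  assumes a: "a \<in> A" and t: "t \<in> curve_dom I \<gamma> a"
  shows "\<tau> t = - ((\<alpha> (\<gamma> t))\<^sup>2 * c\<^sup>2) / 2
    - vector_derivative (\<lambda>s. \<alpha> (\<gamma> s)) (at t within I) * c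
    + frame_sign a t * \<beta> (\<gamma> t) - 1 / (2 * c\<^sup>2)"
  unfolding tau_eta_DN[OF a t] eta_DN[OF a t] using c_nonzero
  by (simp add: field_simps power2_eq_square power3_eq_cube)

lemma W_formula:
  assumes a: "a \<in> A" and t: "t \<in> curve_dom I \<gamma> a"
  shows "W a t = ((- ((\<alpha> (\<gamma> t))\<^sup>2 * c^4) - 1) / (2 * c\<^sup>2)) *\<^sub>R T a t
    - (frame_sign a t * \<alpha> (\<gamma> t)) *\<^sub>R \<phi> a (\<gamma> t) (T a t) + (1 / c) *\<^sub>R \<xi> a (\<gamma> t)"
proof -
  define k where "k = (\<eta> a (\<gamma> t) (D N a t) + 1 / c) / c"
  have "D N a t = k *\<^sub>R T a t
    + (frame_sign a t * \<alpha> (\<gamma> t)) *\<^sub>R \<phi> a (\<gamma> t) (T a t) - (1 / c) *\<^sub>R \<xi> a (\<gamma> t)"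
    unfolding k_def by (rule DN_expansion[OF a t])
  then have "W a t = (- k - \<tau> t) *\<^sub>R T a t
    - (frame_sign a t * \<alpha> (\<gamma> t)) *\<^sub>R \<phi> a (\<gamma> t) (T a t) + (1 / c) *\<^sub>R \<xi> a (\<gamma> t)"
    unfolding W_eq[OF a t] by (simp add: scaleR_diff_left)
  moreover have "- k - \<tau> t = (- ((\<alpha> (\<gamma> t))\<^sup>2 * c^4) - 1) / (2 * c\<^sup>2)"
    unfolding tau_eta_DN[OF a t] k_def using c_nonzero
    by (simp add: field_simps power2_eq_square power4_eq_xxxx)
  ultimately show ?thesis by simp
qed

end

section \<open>The Cartan frame of a slant null curve\<close>

theorem theorem3p1:
  fixes A :: "('m::{t2_space, second_countable_topology}, 3) chart set"
    and \<phi> :: "('m, 3) endofield" and \<xi> :: "('m, 3) vfield" and \<eta> :: "('m, 3) covfield"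
    and g :: "('m, 3) bilfield" and G :: "('m, 3) conn"
    and \<alpha> \<beta> :: "'m \<Rightarrow> real"
    and I :: "real set" and \<gamma> :: "real \<Rightarrow> 'm" and c :: real
    and \<tau> :: "real \<Rightarrow> real" and N W :: "('m, 3) cfield"
  assumes "smooth_manifold A"
    and "almost_paracontact_metric A 1 \<phi> \<xi> \<eta> g"
    and "normal A \<phi> \<xi> \<eta>"
    and "levi_civita A g G"
    and "associated_functions A \<phi> \<xi> G \<alpha> \<beta>"
    and "smooth_curve A I \<gamma>"
    and "slant_curve A \<eta> I \<gamma> c"
    and "null_curve A g I \<gamma>"
    and "\<not> geodesic A G I \<gamma>"
    and "unit_acceleration A g G I \<gamma>"
    and "cartan_frame A g G I \<gamma> \<tau> N W"
  shows "\<exists>\<epsilon>\<in>{1, -1}. \<forall>t\<in>I.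
    \<tau> t = - ((\<alpha> (\<gamma> t))\<^sup>2 * c\<^sup>2) / 2
            - vector_derivative (\<lambda>s. \<alpha> (\<gamma> s)) (at t within I) * c
            + \<epsilon> * \<beta> (\<gamma> t) - 1 / (2 * c\<^sup>2) \<and>
    (\<forall>a\<in>A. \<gamma> t \<in> cdom a \<longrightarrow>
      N a t = (\<alpha> (\<gamma> t) * c) *\<^sub>R velocity I \<gamma> a t
              + (\<epsilon> * (1 / c)) *\<^sub>R \<phi> a (\<gamma> t) (velocity I \<gamma> a t) \<and>
      W a t = ((- ((\<alpha> (\<gamma> t))\<^sup>2 * c^4) - 1) / (2 * c\<^sup>2)) *\<^sub>R velocity I \<gamma> a t
              - (\<epsilon> * \<alpha> (\<gamma> t)) *\<^sub>R \<phi> a (\<gamma> t) (velocity I \<gamma> a t)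
              + (1 / c) *\<^sub>R \<xi> a (\<gamma> t))"
proof -
  interpret framed_null_curve A \<phi> \<xi> \<eta> g G \<alpha> \<beta> I \<gamma> c \<tau> N W
    by unfold_locales (rule assms)+
  obtain \<epsilon> where sign: "\<epsilon> \<in> {1, -1}"
      "\<And>a t. a \<in> A \<Longrightarrow> t \<in> curve_dom I \<gamma> a \<Longrightarrow> frame_sign a t = \<epsilon>"
    by (rule frame_sign_constant, rule that)
  show ?thesis
  proof (intro bexI[of _ \<epsilon>] ballI conjI impI)
    fix t assume t: "t \<in> I"
    obtain a where a: "a \<in> A" "\<gamma> t \<in> cdom a" using chart_at by blast
    then have "t \<in> curve_dom I \<gamma> a" using t by (simp add: curve_dom_def)
    from tau_formula[OF a(1) this] sign(2)[OF a(1) this]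
    show "\<tau> t = - ((\<alpha> (\<gamma> t))\<^sup>2 * c\<^sup>2) / 2
            - vector_derivative (\<lambda>s. \<alpha> (\<gamma> s)) (at t within I) * c
            + \<epsilon> * \<beta> (\<gamma> t) - 1 / (2 * c\<^sup>2)" by simp
  next
    fix t a assume t: "t \<in> I" and a: "a \<in> A" "\<gamma> t \<in> cdom a"
    then have J: "t \<in> curve_dom I \<gamma> a" by (simp add: curve_dom_def)
    note \<epsilon> = sign(2)[OF a(1) J]
    show "N a t = (\<alpha> (\<gamma> t) * c) *\<^sub>R velocity I \<gamma> a t
              + (\<epsilon> * (1 / c)) *\<^sub>R \<phi> a (\<gamma> t) (velocity I \<gamma> a t)"
      using N_expansion[OF a(1) J] by (simp add: \<epsilon>)
    show "W a t = ((- ((\<alpha> (\<gamma> t))\<^sup>2 * c^4) - 1) / (2 * c\<^sup>2)) *\<^sub>R velocity I \<gamma> a t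
              - (\<epsilon> * \<alpha> (\<gamma> t)) *\<^sub>R \<phi> a (\<gamma> t) (velocity I \<gamma> a t)
              + (1 / c) *\<^sub>R \<xi> a (\<gamma> t)"
      using W_formula[OF a(1) J] by (simp add: \<epsilon>)
  qed (rule sign(1))
qed

end
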